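(* Let $\mathcal{H}$ be a real Hilbert space, $A:\mathcal{H}\rightrightarrows\mathcal{H}$ a maximally monotone operator, $D:\mathcal{H}\to\mathcal{H}$ an $\eta$-cocoercive operator with $\eta>0$, $B:\mathcal{H}\to\mathcal{H}$ a $\mu$-cocoercive operator with $\mu>0$, and suppose that $C=\operatorname{zer}B\neq\emptyset$. Let $\lambda,\beta:[0,+\infty)\to(0,+\infty)$ be continuous on each interval $[0,b]$, $0<b<+\infty$, let $x_0\in\mathcal{H}$, and let $x:[0,+\infty)\to\mathcal{H}$ be the strong global solution of $$\dot x(t)+x(t)=J_{\lambda(t)A}\big(x(t)-\lambda(t)Dx(t)-\lambda(t)\beta(t)Bx(t)\big),\qquad x(0)=x_0 .$$ Assume that: - $\limsup_{t\to+\infty}\lambda(t)\beta(t)<2\mu$; - $A+N_C$ is maximally monotone and $\operatorname{zer}(A+D+N_C)\neq\emptyset$; - $\lambda\in L^2([0,+\infty))\setminus L^1([0,+\infty))$; - for every $p\in\operatorname{ran}N_C$, $$\int_0^{+\infty}\lambda(t)\beta(t)\left[\sup_{u\in C}\varphi_B\left(u,\frac{p}{\beta(t)}\right)-\sigma_C\left(\frac{p}{\beta(t)}\right)\right]dt<+\infty .$$ Let $\tilde x$ be defined by $$\tilde x(t)=\frac{1}{\int_0^t\lambda(s)\,ds}\int_0^t\lambda(s)x(s)\,ds .$$ Then: (i) for every $z\in\operatorname{zer}(A+D+N_C)$, $\|x(t)-z\|$ converges as $t\to+\infty$; moreover, $\int_0^{+\infty}\|\dot x(t)\|^2dt<+\infty$,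 $\int_0^{+\infty}\lambda(t)\beta(t)\langle Bx(t),x(t)-z\rangle dt<+\infty$ and $\int_0^{+\infty}\lambda(t)\beta(t)\|Bx(t)\|^2dt<+\infty$; (ii) $\tilde x(t)$ converges weakly to an element of $\operatorname{zer}(A+D+N_C)$ as $t\to+\infty$; (iii) if, additionally, $A$ is strongly monotone, then $x(t)$ converges strongly to the unique element of $\operatorname{zer}(A+D+N_C)$ as $t\to+\infty$.
   Context: For $M:\mathcal{H}\rightrightarrows\mathcal{H}$ (single-valued operators are regarded as set-valued ones with singleton values): $\operatorname{Gr}M=\{(x,u):u\in Mx\}$, $\operatorname{ran}M=\{u:\exists x,\ u\in Mx\}$, $\operatorname{zer}M=\{x:0\in Mx\}$. $M$ is monotone if $\langle x-y,u-v\rangle\ge 0$ for all $(x,u),(y,v)\in\operatorname{Gr}M$; maximally monotone if moreover its graph has no proper monotone extension in $\mathcal{H}\times\mathcal{H}$; strongly monotone if there is $\gamma>0$ with $\langle x-y,u-v\rangle\ge\gamma\|x-y\|^2$ for all $(x,u),(y,v)\in\operatorname{Gr}M$. The resolvent is $J_M=(\operatorname{Id}+M)^{-1}$, which is single-valued and everywhere defined when $M$ is maximally monotone. A single-valued $M:\mathcal{H}\to\mathcal{H}$ is $\gamma$-cocoercive if $\langle x-y,Mx-My\rangle\ge\gamma\|Mx-My\|^2$ for all $x,y\in\mathcal{H}$. The normal cone of $C$ is $N_C(x)=\{u\in\mathcal{H}:\langle y-x,u\rangle\le 0\ \forall y\in C\}$ if $x\in C$ and $N_C(x)=\emptyset$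 otherwise. The support function of $C$ is $\sigma_C(u)=\sup_{y\in C}\langle y,u\rangle$. The Fitzpatrick function of $B$ is $\varphi_B(x,u)=\sup_{(y,v)\in\operatorname{Gr}B}\{\langle x,v\rangle+\langle y,u\rangle-\langle y,v\rangle\}$, with values in $\mathbb{R}\cup\{\pm\infty\}$. A function $f:[0,b]\to\mathcal{H}$ is absolutely continuous if there is an integrable $g:[0,b]\to\mathcal{H}$ with $f(t)=f(0)+\int_0^t g(s)\,ds$ for all $t\in[0,b]$. A strong global solution of the dynamical system is a function $x:[0,+\infty)\to\mathcal{H}$ that is absolutely continuous on each $[0,b]$, $0<b<+\infty$, satisfies the differential equation for almost every $t\in[0,+\infty)$, and satisfies $x(0)=x_0$. Under the continuity assumption on $\lambda,\beta$, such a solution exists and is unique. *)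

theory Defs
  imports "HOL-Analysis.Analysis"
begin

section \<open>Set-valued operators\<close>

type_synonym 'a operator = "'a \<Rightarrow> 'a set"

definition op_of_fun :: "('a \<Rightarrow> 'a) \<Rightarrow> 'a operator" where
  "op_of_fun f = (\<lambda>x. {f x})"

definition op_graph :: "'a operator \<Rightarrow> ('a \<times> 'a) set" where
  "op_graph M = {(x, u). u \<in> M x}"

definition op_ran :: "'a operator \<Rightarrow> 'a set" where
  "op_ran M = {u. \<exists>x. u \<in> M x}"

definition op_zer :: "('a::zero) operator \<Rightarrow> 'a set" where
  "op_zer M = {x. 0 \<in> M x}"

definition op_add :: "('a::plus) operator \<Rightarrow> 'a operator \<Rightarrow> 'a operator" where
  "op_add M N = (\<lambda>x. {u + v | u v. u \<in> M x \<and> v \<in> N x})"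

definition op_scale :: "real \<Rightarrow> ('a::real_vector) operator \<Rightarrow> 'a operator" where
  "op_scale c M = (\<lambda>x. {c *\<^sub>R u | u. u \<in> M x})"

definition op_inverse :: "'a operator \<Rightarrow> 'a operator" where
  "op_inverse M = (\<lambda>u. {x. u \<in> M x})"

definition resolvent :: "('a::plus) operator \<Rightarrow> 'a operator" where
  "resolvent M = op_inverse (op_add (op_of_fun (\<lambda>x. x)) M)"

definition monotone_op :: "('a::real_inner) operator \<Rightarrow> bool" where
  "monotone_op M \<longleftrightarrow>
     (\<forall>(x, u) \<in> op_graph M. \<forall>(y, v) \<in> op_graph M. inner (x - y) (u - v) \<ge> 0)"

definition maximally_monotone :: "('a::real_inner) operator \<Rightarrow> bool" where
  "maximally_monotone M \<longleftrightarrow>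
     monotone_op M \<and> (\<forall>N. monotone_op N \<longrightarrow> \<not> op_graph M \<subset> op_graph N)"

definition strongly_monotone :: "('a::real_inner) operator \<Rightarrow> bool" where
  "strongly_monotone M \<longleftrightarrow>
     (\<exists>\<gamma>>0. \<forall>(x, u) \<in> op_graph M. \<forall>(y, v) \<in> op_graph M.
        inner (x - y) (u - v) \<ge> \<gamma> * (norm (x - y))\<^sup>2)"

definition cocoercive :: "real \<Rightarrow> ('a::real_inner \<Rightarrow> 'a) \<Rightarrow> bool" where
  "cocoercive \<gamma> M \<longleftrightarrow>
     (\<forall>x y. inner (x - y) (M x - M y) \<ge> \<gamma> * (norm (M x - M y))\<^sup>2)"

definition normal_cone :: "('a::real_inner) set \<Rightarrow> 'a operator" where
  "normal_cone C = (\<lambda>x. if x \<in> C then {u. \<forall>y\<in>C. inner (y - x) u \<le> 0} else {})"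

definition support_function :: "('a::real_inner) set \<Rightarrow> 'a \<Rightarrow> ereal" where
  "support_function C u = (SUP y\<in>C. ereal (inner y u))"

definition fitzpatrick :: "('a::real_inner) operator \<Rightarrow> 'a \<Rightarrow> 'a \<Rightarrow> ereal" where
  "fitzpatrick B x u = (SUP (y, v)\<in>op_graph B. ereal (inner x v + inner y u - inner y v))"


section \<open>Absolute continuity and strong solutions\<close>

text \<open>
  The library's Bochner integral is restricted to second-countable (hence separable) ranges.
  The next predicate is the usual definition without that restriction: \<open>f\<close> is an almost
  everywhere limit of integrable simple functions which also converge to \<open>f\<close> in mean, and
  \<open>I\<close> is the limit of their integrals.
\<close>

definition has_strong_bochner_integral ::
    "'m measure \<Rightarrow> ('m \<Rightarrow> 'b::real_normed_vector) \<Rightarrow> 'b \<Rightarrow> bool" where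
  "has_strong_bochner_integral M f I \<longleftrightarrow>
     (\<exists>s. (\<forall>i. Bochner_Integration.simple_bochner_integrable M (s i)) \<and>
          (AE t in M. (\<lambda>i. s i t) \<longlonglongrightarrow> f t) \<and>
          (\<lambda>i. \<integral>\<^sup>+t. ennreal (norm (f t - s i t)) \<partial>M) \<longlonglongrightarrow> 0 \<and>
          (\<lambda>i. Bochner_Integration.simple_bochner_integral M (s i)) \<longlonglongrightarrow> I)"

text \<open>Integrability of \<open>g\<close> on the whole of \<open>{0..b}\<close> is the instance \<open>t = b\<close>.\<close>

definition abs_continuous_upto :: "real \<Rightarrow> (real \<Rightarrow> 'b::real_normed_vector) \<Rightarrow> bool" where
  "abs_continuous_upto b f \<longleftrightarrow>
     (\<exists>g. \<forall>t\<in>{0..b}. \<exists>I. has_strong_bochner_integral (lebesgue_on {0..t}) g I \<and> f t = f 0 + I)"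

text \<open>
  Trajectories live on the half-line, so derivatives are taken within \<open>{0..}\<close>; values at
  negative times are irrelevant.
\<close>

definition velocity :: "(real \<Rightarrow> 'a::real_normed_vector) \<Rightarrow> real \<Rightarrow> 'a" where
  "velocity x t = vector_derivative x (at t within {0..})"

text \<open>
  The resolvent is a set-valued operator here, and a single value is identified with the
  corresponding singleton; hence the singleton in the differential equation.
\<close>

definition strong_global_solution ::
    "('a::real_inner) operator \<Rightarrow> ('a \<Rightarrow> 'a) \<Rightarrow> ('a \<Rightarrow> 'a) \<Rightarrow>
     (real \<Rightarrow> real) \<Rightarrow> (real \<Rightarrow> real) \<Rightarrow> 'a \<Rightarrow> (real \<Rightarrow> 'a) \<Rightarrow> bool" where
  "strong_global_solution A D B lam bet x0 x \<longleftrightarrow>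
     (\<forall>b>0. abs_continuous_upto b x) \<and>
     (AE t in lebesgue. t \<ge> 0 \<longrightarrow>
        x differentiable (at t within {0..}) \<and>
        resolvent (op_scale (lam t) A)
          (x t - lam t *\<^sub>R D (x t) - (lam t * bet t) *\<^sub>R B (x t)) = {velocity x t + x t}) \<and>
     x 0 = x0"


section \<open>Asymptotics\<close>

text \<open>
  For continuous integrands on compact intervals the gauge integral, which the library
  provides for arbitrary Banach-valued functions, coincides with the Bochner integral.
\<close>

definition weighted_average ::
    "(real \<Rightarrow> real) \<Rightarrow> (real \<Rightarrow> 'a::real_normed_vector) \<Rightarrow> real \<Rightarrow> 'a" where
  "weighted_average lam x t =
     (1 / integral {0..t} lam) *\<^sub>R integral {0..t} (\<lambda>s. lam s *\<^sub>R x s)"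

definition weakly_tendsto ::
    "('b \<Rightarrow> 'a::real_inner) \<Rightarrow> 'a \<Rightarrow> 'b filter \<Rightarrow> bool" where
  "weakly_tendsto f l F \<longleftrightarrow> (\<forall>y. ((\<lambda>t. inner (f t) y) \<longlongrightarrow> inner l y) F)"

text \<open>
  Integral over the half-line of an extended-real function that is nonnegative there.  The
  truncation at zero performed by \<open>e2ennreal\<close> is then vacuous.
\<close>

definition halfline_integral :: "(real \<Rightarrow> ereal) \<Rightarrow> ennreal" where
  "halfline_integral f = (\<integral>\<^sup>+t\<in>{0..}. e2ennreal (f t) \<partial>lebesgue)"

end

theory Submission
  imports Defs
begin

text \<open>
  Fix \<open>(z, w)\<close> in the graph of \<open>A + D + N_C\<close> with \<open>w = a + D z + p\<close>. Monotonicity of \<open>A\<close> at the point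
  \<open>x + x'\<close>, cocoercivity of \<open>B\<close> and \<open>D\<close>, and Young's inequality bound the derivative of
  \<open>h = \<parallel>x - z\<parallel>\<^sup>2\<close> by dissipative terms, the term \<open>- 2 \<lambda> \<langle>x - z, w\<rangle>\<close>, a multiple of
  \<open>\<lambda>\<^sup>2 h\<close>, and integrable terms, one of which is the Fitzpatrick gap. For \<open>w = 0\<close> a Gronwall argument
  gives (i). For general \<open>w\<close>, dividing the integrated inequality by \<open>\<integral>\<lambda>\<close>, which diverges, gives
  \<open>limsup \<langle>x~ - z, w\<rangle> \<le> 0\<close> for the averages \<open>x~\<close>. By Minty's theorem for \<open>A + N_C\<close> and the
  Lipschitz continuity of \<open>D\<close>, points \<open>y\<close> with \<open>\<langle>y - z, w\<rangle> \<le> 0\<close> for all such pairs are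
  zeros, and an Opial argument yields weak convergence. Strong monotonicity adds \<open>\<gamma> \<lambda> h\<close> to
  the dissipation; as \<open>\<lambda>\<close> is not integrable, the limit of \<open>h\<close> must vanish.
\<close>

section \<open>Absolutely continuous functions\<close>

text \<open>The inclusion evaluates \<open>A\<close> at \<open>x + x'\<close> but \<open>D\<close>
  and \<open>B\<close> at \<open>x\<close>, so pairing with \<open>x + x' - z\<close> leaves cross
  terms with \<open>x'\<close>. Each carries a factor \<open>lam\<close>; Young's inequality trades
  it for a share of the squared speed and a term in \<open>lam\<close> squared, which is where
  square integrability of \<open>lam\<close> is spent. The cross term with \<open>B\<close> is
  different: no square integrability of \<open>lam * bet\<close> is at hand, so it is paid out of
  the dissipation of \<open>B\<close>, and the bound \<open>2 * \<mu>\<close> leaves a surplus. The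
  order of the estimates follows from the linear term. It vanishes for \<open>w = 0\<close>, so
  Gronwall's inequality is applied there; the boundedness of \<open>x\<close> obtained at one zero
  then makes the growth term integrable for every other pair, where the linear term has no sign. The
  space is not assumed separable. Vector identities are therefore tested against vectors, often
  against the very vector to be estimated, so that almost every integral is one of a real
  function.\<close>

text \<open>
  The derivative is only given off a null set \<open>N\<close>. Henstock's lemma for the density \<open>\<gamma>\<close>,
  redefined as \<open>0\<close> on \<open>N\<close>, makes the integrals of \<open>\<gamma>\<close> over the intervals tagged in \<open>N\<close>
  small, and these dominate the increments of \<open>f\<close> there.
\<close>

lemma has_integral_of_dominated_increments:
  fixes f :: "real \<Rightarrow> 'b::real_normed_vector" and \<gamma> :: "real \<Rightarrow> real"
  assumes "a \<le> b" and N: "negligible N"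
    and der: "\<And>t. t \<in> {a..b} - N \<Longrightarrow> (f has_vector_derivative f' t) (at t within {a..b})"
    and int: "\<gamma> integrable_on {a..b}"
    and dom: "\<And>s t. a \<le> s \<Longrightarrow> s \<le> t \<Longrightarrow> t \<le> b \<Longrightarrow> norm (f t - f s) \<le> integral {s..t} \<gamma>"
  shows "(f' has_integral (f b - f a)) {a..b}"
proof -
  define g where "g t = (if t \<in> N then 0 else f' t)" for t
  define \<gamma>0 where "\<gamma>0 t = (if t \<in> N then 0 else \<gamma> t)" for t
  have int0: "\<gamma>0 integrable_on cbox a b"
    using integrable_spike[OF int N, of \<gamma>0] by (simp add: \<gamma>0_def)
  have eq0: "integral S \<gamma>0 = integral S \<gamma>" for S
    by (rule integral_spike[OF N]) (simp add: \<gamma>0_def)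
  have "(g has_integral (f b - f a)) (cbox a b)"
    unfolding has_integral
  proof (intro allI impI)
    fix e :: real
    assume "e > 0"
    \<comment> \<open>The slope errors add up to \<open>e' * (b - a)\<close> and Henstock's lemma
      contributes less than one further \<open>e'\<close>.\<close>
    define e' where "e' = e / (b - a + 1)"
    have "e' > 0" using \<open>e > 0\<close> \<open>a \<le> b\<close> by (simp add: e'_def)
    obtain d1 where d1: "gauge d1"
      "\<And>p. \<lbrakk>p tagged_partial_division_of (cbox a b); d1 fine p\<rbrakk> \<Longrightarrow>
             (\<Sum>(x,k)\<in>p. norm (measure lborel k *\<^sub>R \<gamma>0 x - integral k \<gamma>0)) < e'"
      using Henstock_lemma[OF int0 \<open>e' > 0\<close>] by blast
    define straddle where "straddle x \<delta> \<longleftrightarrow> \<delta> > 0 \<and> (x \<in> {a..b} - N \<longrightarrow>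
        (\<forall>y\<in>{a..b}. norm (y-x) < \<delta> \<longrightarrow> norm (f y - f x - (y-x) *\<^sub>R f' x) \<le> e' * norm (y-x)))" for x \<delta>
    have "\<exists>\<delta>. straddle x \<delta>" for x
    proof (cases "x \<in> {a..b} - N")
      case True
      then show ?thesis
        using der[OF True, unfolded has_vector_derivative_def has_derivative_within_alt] \<open>e' > 0\<close>
        unfolding straddle_def by blast
    next
      case False
      then have "straddle x 1" unfolding straddle_def using zero_less_one by blast
      then show ?thesis by blast
    qed
    then have "\<exists>d. \<forall>x. straddle x (d x)" by (intro choice) blast
    then obtain d where "\<And>x. straddle x (d x)" by blast
    note sd = this[unfolded straddle_def]
    have d: "0 < d x" for x using sd by (rule conjunct1)
    have d': "norm (f y - f x - (y-x) *\<^sub>R f' x) \<le> e' * norm (y-x)"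
      if "x \<in> {a..b} - N" "y \<in> {a..b}" "norm (y-x) < d x" for x y
      using sd[of x, THEN conjunct2, THEN mp, OF that(1), THEN bspec, OF that(2), THEN mp, OF that(3)] .
    show "\<exists>\<gamma>. gauge \<gamma> \<and> (\<forall>\<D>. \<D> tagged_division_of cbox a b \<and> \<gamma> fine \<D> \<longrightarrow>
            norm ((\<Sum>(x, k)\<in>\<D>. measure lborel k *\<^sub>R g x) - (f b - f a)) < e)"
    proof (intro exI conjI allI impI)
      show "gauge (\<lambda>x. d1 x \<inter> ball x (d x))"
        by (rule gauge_Int[OF d1(1) gauge_ball_dependent]) (simp add: d)
    next
      fix p
      assume asm: "p tagged_division_of cbox a b \<and> (\<lambda>x. d1 x \<inter> ball x (d x)) fine p"
      then have ptag: "p tagged_division_of cbox a b" and fine1: "d1 fine p"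
        and fine2: "(\<lambda>x. ball x (d x)) fine p" by (auto simp: fine_Int)
      have ba: "b - a = (\<Sum>(x,K)\<in>p. Sup K - Inf K)" "f b - f a = (\<Sum>(x,K)\<in>p. f(Sup K) - f(Inf K))"
        using additive_tagged_division_1[where f= "\<lambda>x. x"] additive_tagged_division_1[where f= f]
            \<open>a \<le> b\<close> ptag by auto
      have "norm ((\<Sum>(x, k)\<in>p. measure lborel k *\<^sub>R g x) - (f b - f a))
          = norm (\<Sum>(x, k)\<in>p. measure lborel k *\<^sub>R g x - (f(Sup k) - f(Inf k)))"
        unfolding ba by (simp add: sum_subtractf split_def)
      also have "\<dots> \<le> (\<Sum>(x,k)\<in>p. e' * (Sup k - Inf k) + norm (measure lborel k *\<^sub>R \<gamma>0 x - integral k \<gamma>0))"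
      proof (rule sum_norm_le, safe)
        fix x K
        assume "(x, K) \<in> p"
        then have "x \<in> K" and kab: "K \<subseteq> cbox a b"
          using ptag by blast+
        then obtain u v where k: "K = cbox u v"
          using ptag \<open>(x, K) \<in> p\<close> by auto
        have "u \<le> x" "x \<le> v" "a \<le> u" "v \<le> b"
          using \<open>x \<in> K\<close> kab unfolding k by auto
        then have "u \<le> v" by simp
        have ball: "y \<in> ball x (d x)" if "y \<in> K" for y
          using fine2 \<open>(x, K) \<in> p\<close> that by blast
        have uv: "norm (u - x) < d x" "norm (v - x) < d x"
          using ball[of u] ball[of v] \<open>u \<le> v\<close> by (auto simp: k dist_real_def)
        have "norm ((v - u) *\<^sub>R g x - (f v - f u))
                \<le> e' * (v - u) + norm ((v - u) *\<^sub>R \<gamma>0 x - integral {u..v} \<gamma>0)"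
        proof (cases "x \<in> N")
          case True
          then have "norm ((v - u) *\<^sub>R g x - (f v - f u)) \<le> integral {u..v} \<gamma>"
            using dom[of u v] \<open>a \<le> u\<close> \<open>v \<le> b\<close> \<open>u \<le> v\<close> by (simp add: g_def norm_minus_commute)
          also have "\<dots> \<le> norm ((v - u) *\<^sub>R \<gamma>0 x - integral {u..v} \<gamma>0)"
            using True by (simp add: eq0) (simp add: \<gamma>0_def)
          finally show ?thesis using \<open>u \<le> v\<close> \<open>e' > 0\<close>
            by (smt (verit) mult_nonneg_nonneg)
        next
          case False
          \<comment> \<open>The tag \<open>x\<close> lies between \<open>u\<close> and
            \<open>v\<close> and need not be an endpoint, so both ends are compared with it.\<close>
          have "(v - u) *\<^sub>R g x - (f v - f u)
             = (f u - f x - (u - x) *\<^sub>R f' x) - (f v - f x - (v - x) *\<^sub>R f' x)"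
            using False by (simp add: g_def algebra_simps)
          then have "norm ((v - u) *\<^sub>R g x - (f v - f u))
             \<le> norm (f u - f x - (u - x) *\<^sub>R f' x) + norm (f v - f x - (v - x) *\<^sub>R f' x)"
            by (metis norm_triangle_ineq4)
          also have "\<dots> \<le> e' * norm (u - x) + e' * norm (v - x)"
            using False uv \<open>u \<le> x\<close> \<open>x \<le> v\<close> \<open>a \<le> u\<close> \<open>v \<le> b\<close>
            by (intro add_mono d') auto
          also have "\<dots> = e' * (v - u)"
            using \<open>u \<le> x\<close> \<open>x \<le> v\<close> by (simp add: algebra_simps)
          finally show ?thesis by (smt (verit) norm_ge_zero)
        qed
        then show "norm (measure lborel K *\<^sub>R g x - (f (Sup K) - f (Inf K)))
            \<le> e' * (Sup K - Inf K) + norm (measure lborel K *\<^sub>R \<gamma>0 x - integral K \<gamma>0)"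
          using \<open>u \<le> v\<close> by (simp add: k)
      qed
      also have "\<dots> = e' * (b - a) + (\<Sum>(x,k)\<in>p. norm (measure lborel k *\<^sub>R \<gamma>0 x - integral k \<gamma>0))"
        unfolding ba by (simp add: sum.distrib sum_distrib_left split_def)
      also have "\<dots> < e' * (b - a) + e'"
        using d1(2)[OF _ fine1] ptag by (simp add: tagged_division_of_def)
      also have "\<dots> = e' * (b - a + 1)" by (simp add: distrib_left)
      also have "\<dots> = e" using \<open>a \<le> b\<close> by (simp add: e'_def)
      finally show "norm ((\<Sum>(x, k)\<in>p. measure lborel k *\<^sub>R g x) - (f b - f a)) < e" .
    qed
  qed
  then show ?thesis
    using has_integral_spike[OF N, of "{a..b}" f' g] by (simp add: g_def)
qed

text \<open>Setting all functions to 0 on the exceptional null set makes the convergence hold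
  everywhere; undoing this change keeps measurability because Lebesgue measure is complete. Norms of
  integrands and of the velocity arise only as such almost everywhere limits.\<close>

lemma borel_measurable_lebesgue_on_AE_limit:
  fixes f :: "real \<Rightarrow> real" and S :: "real set"
  assumes S: "S \<in> sets lebesgue"
    and "\<And>i. s i \<in> borel_measurable (lebesgue_on S)"
    and "AE t in lebesgue_on S. (\<lambda>i. s i t) \<longlonglongrightarrow> f t"
  shows "f \<in> borel_measurable (lebesgue_on S)"
proof -
  let ?s = "\<lambda>i t. if t \<in> S then s i t else 0"
  obtain N where N: "N \<in> null_sets lebesgue" "\<And>t. t \<in> S - N \<Longrightarrow> (\<lambda>i. s i t) \<longlonglongrightarrow> f t"
  proof -
    have "AE t in lebesgue. t \<in> S \<longrightarrow> (\<lambda>i. s i t) \<longlonglongrightarrow> f t"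
      using assms(3) S by (simp add: AE_restrict_space_iff)
    then show ?thesis using that by (auto simp: completion.AE_iff_null_sets)
  qed
  let ?s' = "\<lambda>i t. if t \<in> N then 0 else ?s i t"
  let ?f' = "\<lambda>t. if t \<in> N \<or> t \<notin> S then 0 else f t"
  have meas: "?s i \<in> borel_measurable lebesgue" for i
    using assms(2)[of i] S by (simp add: borel_measurable_if)
  have NS: "N \<in> sets lebesgue" using N(1) by auto
  have 1: "?f' \<in> borel_measurable lebesgue"
  proof (rule borel_measurable_LIMSEQ_real)
    show "?s' i \<in> borel_measurable lebesgue" for i
      using measurable_If_set[OF measurable_const meas[of i], where A = N] NS by simp
    show "(\<lambda>i. ?s' i t) \<longlonglongrightarrow> ?f' t" for t
      using N(2)[of t] by (cases "t \<in> N"; cases "t \<in> S") auto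
  qed
  have "(\<lambda>t. if t \<in> S then f t else 0) \<in> borel_measurable lebesgue"
  proof (rule borel_measurable_AE[OF 1])
    show "AE t in lebesgue. ?f' t = (if t \<in> S then f t else 0)"
      using AE_not_in[OF N(1)] by eventually_elim auto
  qed
  then show ?thesis using S by (simp add: borel_measurable_if)
qed

text \<open>The images under \<open>L\<close> of the approximating simple functions approximate
  \<open>L (g t)\<close>, with errors in mean enlarged by at most the factor \<open>K\<close>. This
  is how increments of an absolutely continuous curve become real integrals.\<close>

lemma has_strong_bochner_integral_bounded_linear:
  fixes g :: "real \<Rightarrow> 'b::real_normed_vector" and L :: "'b \<Rightarrow> real"
  assumes S: "S \<in> sets lebesgue" and L: "bounded_linear L"
    and "has_strong_bochner_integral (lebesgue_on S) g I"
  shows "has_bochner_integral (lebesgue_on S) (\<lambda>t. L (g t)) (L I)"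
proof -
  interpret L: bounded_linear L by fact
  obtain K where K: "K > 0" "\<And>x. norm (L x) \<le> norm x * K"
    using L.pos_bounded by blast
  obtain s where s: "\<And>i. Bochner_Integration.simple_bochner_integrable (lebesgue_on S) (s i)"
      "AE t in lebesgue_on S. (\<lambda>i. s i t) \<longlonglongrightarrow> g t"
      "(\<lambda>i. \<integral>\<^sup>+t. ennreal (norm (g t - s i t)) \<partial>lebesgue_on S) \<longlonglongrightarrow> 0"
      "(\<lambda>i. Bochner_Integration.simple_bochner_integral (lebesgue_on S) (s i)) \<longlonglongrightarrow> I"
    using assms(3) unfolding has_strong_bochner_integral_def by blast
  show ?thesis
  proof (rule has_bochner_integral.intros)
    have Ls: "simple_function (lebesgue_on S) (\<lambda>t. L (s i t))" for i
      using s(1)[of i] by (auto simp: Bochner_Integration.simple_bochner_integrable.simps intro: simple_function_compose1[where g = L])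
    show "Bochner_Integration.simple_bochner_integrable (lebesgue_on S) (\<lambda>t. L (s i t))" for i
      using simple_bochner_integrable_compose2[of "\<lambda>a b. L a", OF L.zero s(1) s(1)] .
    show "(\<lambda>t. L (g t)) \<in> borel_measurable (lebesgue_on S)"
    proof (rule borel_measurable_lebesgue_on_AE_limit[OF S])
      show "(\<lambda>t. L (s i t)) \<in> borel_measurable (lebesgue_on S)" for i
        by (rule borel_measurable_simple_function[OF Ls])
      show "AE t in lebesgue_on S. (\<lambda>i. L (s i t)) \<longlonglongrightarrow> L (g t)"
        using s(2) by eventually_elim (rule L.tendsto)
    qed
    show "(\<lambda>i. Bochner_Integration.simple_bochner_integral (lebesgue_on S) (\<lambda>t. L (s i t))) \<longlonglongrightarrow> L I"
      using L.tendsto[OF s(4)] simple_bochner_integral_linear[OF L.linear_axioms s(1)] by simp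
    have "(\<integral>\<^sup>+t. ennreal (norm (L (g t) - L (s i t))) \<partial>lebesgue_on S)
        \<le> (\<integral>\<^sup>+t. ennreal K * ennreal (norm (g t - s i t)) \<partial>lebesgue_on S)" for i
      using K by (intro nn_integral_mono) (simp add: ennreal_mult[symmetric] L.diff[symmetric] mult.commute ennreal_leI)
    also have "(\<integral>\<^sup>+t. ennreal K * ennreal (norm (g t - s i t)) \<partial>lebesgue_on S)
        = ennreal K * (\<integral>\<^sup>+t. ennreal (norm (g t - s i t)) \<partial>lebesgue_on S)" for i
    proof (rule nn_integral_cmult)
      have "(\<lambda>t. norm (g t - s i t)) \<in> borel_measurable (lebesgue_on S)"
      proof (rule borel_measurable_lebesgue_on_AE_limit[OF S])
        have sf: "simple_function (lebesgue_on S) (s j)" for j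
          using s(1) by (auto simp: Bochner_Integration.simple_bochner_integrable.simps)
        show "(\<lambda>t. norm (s j t - s i t)) \<in> borel_measurable (lebesgue_on S)" for j
          by (rule borel_measurable_simple_function[OF simple_function_compose2[where h = "\<lambda>a b. norm (a - b)", OF sf sf]])
        show "AE t in lebesgue_on S. (\<lambda>j. norm (s j t - s i t)) \<longlonglongrightarrow> norm (g t - s i t)"
          using s(2) by eventually_elim (intro tendsto_intros)
      qed
      then show "(\<lambda>t. ennreal (norm (g t - s i t))) \<in> borel_measurable (lebesgue_on S)"
        by measurable
    qed
    finally have le: "(\<integral>\<^sup>+t. ennreal (norm (L (g t) - L (s i t))) \<partial>lebesgue_on S)
        \<le> ennreal K * (\<integral>\<^sup>+t. ennreal (norm (g t - s i t)) \<partial>lebesgue_on S)" for i .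
    have "(\<lambda>i. ennreal K * (\<integral>\<^sup>+t. ennreal (norm (g t - s i t)) \<partial>lebesgue_on S)) \<longlonglongrightarrow> 0"
      using ennreal_tendsto_cmult[OF _ s(3), of "ennreal K"] by simp
    then show "(\<lambda>i. \<integral>\<^sup>+t. ennreal (norm (L (g t) - L (s i t))) \<partial>lebesgue_on S) \<longlonglongrightarrow> 0"
      by (rule tendsto_sandwich[OF always_eventually always_eventually tendsto_const, rotated 2])
         (use le in simp_all)
  qed
qed

lemma abs_continuous_upto_dominated:
  fixes x :: "real \<Rightarrow> 'b::real_inner"
  assumes "abs_continuous_upto b x" and "0 \<le> b"
  obtains \<gamma> where "\<gamma> integrable_on {0..b}" "\<And>t. 0 \<le> \<gamma> t"
    "\<And>s t. 0 \<le> s \<Longrightarrow> s \<le> t \<Longrightarrow> t \<le> b \<Longrightarrow> norm (x t - x s) \<le> integral {s..t} \<gamma>"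
proof -
  obtain g where g: "\<And>t. t \<in> {0..b} \<Longrightarrow>
      \<exists>I. has_strong_bochner_integral (lebesgue_on {0..t}) g I \<and> x t = x 0 + I"
    using assms(1) unfolding abs_continuous_upto_def by blast
  let ?M = "lebesgue_on {0..b}"
  have gI: "has_strong_bochner_integral (lebesgue_on {0..t}) g (x t - x 0)" if "t \<in> {0..b}" for t
    using g[OF that] by auto
  obtain s where s: "\<And>i. Bochner_Integration.simple_bochner_integrable ?M (s i)"
      "AE t in ?M. (\<lambda>i. s i t) \<longlonglongrightarrow> g t"
      "(\<lambda>i. \<integral>\<^sup>+t. ennreal (norm (g t - s i t)) \<partial>?M) \<longlonglongrightarrow> 0"
    using gI[of b] \<open>0 \<le> b\<close> unfolding has_strong_bochner_integral_def by auto
  have simple: "simple_function ?M (s j)" for j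
    using s(1) by (auto simp: Bochner_Integration.simple_bochner_integrable.simps)
  have meas: "(\<lambda>t. norm (g t)) \<in> borel_measurable ?M"
  proof (rule borel_measurable_lebesgue_on_AE_limit)
    show "(\<lambda>t. norm (s j t)) \<in> borel_measurable ?M" for j
      by (rule borel_measurable_simple_function[OF simple_function_compose1[where g = norm, OF simple]])
    show "AE t in ?M. (\<lambda>j. norm (s j t)) \<longlonglongrightarrow> norm (g t)"
      using s(2) by eventually_elim (intro tendsto_intros)
  qed simp
  have "integrable ?M (\<lambda>t. norm (g t))"
  proof (rule integrableI_bounded[OF meas])
    \<comment> \<open>One simple function at distance less than 1 in mean already makes the integral
      of \<open>norm (g t)\<close> finite.\<close>
    obtain i where i: "(\<integral>\<^sup>+t. ennreal (norm (g t - s i t)) \<partial>?M) < 1"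
      using order_tendstoD(2)[OF s(3), of 1] eventually_sequentially by auto
    have sn: "Bochner_Integration.simple_bochner_integrable ?M (\<lambda>t. norm (s i t))"
      using Bochner_Integration.simple_bochner_integrable_compose2[of "\<lambda>a b. norm a", OF norm_zero s(1) s(1)] .
    have fin: "(\<integral>\<^sup>+t. ennreal (norm (s i t)) \<partial>?M) < \<infinity>"
      using integrableD(2)[OF integrable.intros[OF Bochner_Integration.has_bochner_integral_simple_bochner_integrable[OF sn]]]
      by (simp add: top.not_eq_extremum)
    have "(\<lambda>t. norm (g t - s i t)) \<in> borel_measurable ?M"
    proof (rule borel_measurable_lebesgue_on_AE_limit)
      show "(\<lambda>t. norm (s j t - s i t)) \<in> borel_measurable ?M" for j
        by (rule borel_measurable_simple_function[OF simple_function_compose2[where h = "\<lambda>a b. norm (a - b)", OF simple simple]])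
      show "AE t in ?M. (\<lambda>j. norm (s j t - s i t)) \<longlonglongrightarrow> norm (g t - s i t)"
        using s(2) by eventually_elim (intro tendsto_intros)
    qed simp
    moreover have "(\<lambda>t. norm (s i t)) \<in> borel_measurable ?M"
      by (rule borel_measurable_simple_function[OF simple_function_compose1[where g = norm, OF simple]])
    moreover have "norm (g t) \<le> norm (g t - s i t) + norm (s i t)" for t
      by (metis diff_add_cancel norm_triangle_ineq)
    ultimately have "(\<integral>\<^sup>+t. ennreal (norm (g t)) \<partial>?M)
        \<le> (\<integral>\<^sup>+t. ennreal (norm (g t - s i t)) \<partial>?M) + (\<integral>\<^sup>+t. ennreal (norm (s i t)) \<partial>?M)"
      by (subst nn_integral_add[symmetric])
         (auto intro!: nn_integral_mono simp: ennreal_plus[symmetric] simp del: ennreal_plus)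
    also have "\<dots> < \<infinity>"
      using fin i by (auto simp: less_top[symmetric])
    finally show "(\<integral>\<^sup>+t. ennreal (norm (norm (g t))) \<partial>?M) < \<infinity>" by simp
  qed
  then have int: "(\<lambda>t. norm (g t)) integrable_on {0..b}"
    by (rule integrable_on_lebesgue_on) simp
  have ginn: "((\<lambda>\<tau>. inner (g \<tau>) e) has_integral inner (x t - x 0) e) {0..t}" if "t \<in> {0..b}" for t e
    using has_strong_bochner_integral_bounded_linear[OF _ bounded_linear_inner_left gI[OF that], of e]
    by (auto simp: has_integral_iff has_bochner_integral_iff integrable_on_lebesgue_on
        simp flip: lebesgue_integral_eq_integral)
  have "norm (x t - x s) \<le> integral {s..t} (\<lambda>t. norm (g t))" if "0 \<le> s" "s \<le> t" "t \<le> b" for s t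
  proof -
    \<comment> \<open>The increment is paired with itself: its squared norm is a real integral, at
      most \<open>norm e\<close> times the integral of \<open>norm (g \<tau>)\<close>, and one
      factor \<open>norm e\<close> cancels.\<close>
    define e where "e = x t - x s"
    have st: "s \<in> {0..b}" "t \<in> {0..b}" using that by auto
    have sub: "(\<lambda>\<tau>. inner (g \<tau>) e) integrable_on {s..t}" "(\<lambda>t. norm (g t)) integrable_on {s..t}"
      using ginn[OF st(2), of e] int that
      by (auto intro: integrable_subinterval_real simp: has_integral_iff)
    have "integral {0..s} (\<lambda>\<tau>. inner (g \<tau>) e) + integral {s..t} (\<lambda>\<tau>. inner (g \<tau>) e)
        = integral {0..t} (\<lambda>\<tau>. inner (g \<tau>) e)"
      using that ginn[OF st(2), of e]
      by (intro Henstock_Kurzweil_Integration.integral_combine) (auto simp: has_integral_iff)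
    then have "integral {s..t} (\<lambda>\<tau>. inner (g \<tau>) e) = inner (x t - x 0) e - inner (x s - x 0) e"
      using ginn[OF st(1), of e] ginn[OF st(2), of e] by (simp add: has_integral_iff)
    then have "(norm e)\<^sup>2 = integral {s..t} (\<lambda>\<tau>. inner (g \<tau>) e)"
      by (simp add: e_def power2_norm_eq_inner inner_diff_left)
    also have "\<dots> \<le> integral {s..t} (\<lambda>\<tau>. norm (g \<tau>) * norm e)"
      using sub by (intro integral_le integrable_on_mult_left norm_cauchy_schwarz) auto
    also have "\<dots> = integral {s..t} (\<lambda>\<tau>. norm (g \<tau>)) * norm e" by simp
    finally have "norm e * norm e \<le> integral {s..t} (\<lambda>\<tau>. norm (g \<tau>)) * norm e"
      by (simp add: power2_eq_square)
    moreover have "0 \<le> integral {s..t} (\<lambda>\<tau>. norm (g \<tau>))"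
      using sub by (intro integral_nonneg) auto
    ultimately show ?thesis
      unfolding e_def[symmetric] by (cases "norm e = 0") (auto simp: mult_le_cancel_right)
  qed
  with int show thesis by (intro that[of "\<lambda>t. norm (g t)"]) auto
qed

text \<open>
  The library's integrability of continuous functions asks for the class \<open>banach\<close>, which the sort
  \<open>{real_inner, complete_space}\<close> does not imply. Testing the difference of two Riemann sums
  against itself reduces the Cauchy criterion to real integrands.
\<close>

lemma integrable_continuous_Hilbert:
  fixes f :: "real \<Rightarrow> 'b::{real_inner, complete_space}"
  assumes cont: "continuous_on {a..b} f"
  shows "f integrable_on {a..b}"
proof (cases "a \<le> b")
  case True
  have "f integrable_on cbox a b"
    unfolding integrable_Cauchy
  proof (intro allI impI)
    fix e :: real
    assume "e > 0"
    define e' where "e' = e / 3 / (b - a + 1)"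
    have "e' > 0" using \<open>e > 0\<close> True by (simp add: e'_def)
    have e'_le: "2 * (b - a) * e' < e"
    proof -
      have "e / 3 / w * w = e / 3" if "w > 0" for w using that by simp
      from this[of "b - a + 1"] have "e' * (b - a + 1) = e / 3" using True by (simp only: e'_def)
      then have "2 * (b - a) * e' = 2 * (e / 3) - 2 * e'" by (simp add: algebra_simps)
      then show ?thesis using \<open>e > 0\<close> \<open>e' > 0\<close> by linarith
    qed
    have "uniformly_continuous_on {a..b} f"
      using cont by (simp add: compact_uniformly_continuous)
    then obtain d where d: "d > 0"
      "\<And>s t. s \<in> {a..b} \<Longrightarrow> t \<in> {a..b} \<Longrightarrow> dist t s < d \<Longrightarrow> dist (f t) (f s) < e'"
      using \<open>e' > 0\<close> unfolding uniformly_continuous_on_def by metis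
    \<comment> \<open>The error is proportional to \<open>norm w\<close> and uniform in
      \<open>w\<close>, so \<open>w\<close> may later be the difference of two Riemann sums and one
      factor of its norm cancels.\<close>
    have approx: "\<bar>inner (\<Sum>(x, K)\<in>\<D>. measure lborel K *\<^sub>R f x) w - integral (cbox a b) (\<lambda>t. inner (f t) w)\<bar>
        \<le> (b - a) * (e' * norm w)"
      if \<D>: "\<D> tagged_division_of cbox a b" and fine: "(\<lambda>x. ball x d) fine \<D>" for \<D> w
    proof -
      let ?\<phi> = "\<lambda>t. inner (f t) w"
      have cont\<phi>: "continuous_on {a..b} ?\<phi>" using cont by (intro continuous_intros)
      have "?\<phi> integrable_on cbox a b" using integrable_continuous_real[OF cont\<phi>] by simp
      then have "integral (cbox a b) ?\<phi> = (\<Sum>(x,K)\<in>\<D>. integral K ?\<phi>)"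
        using \<D> by (rule integral_combine_tagged_division_topdown)
      then have "\<bar>inner (\<Sum>(x, K)\<in>\<D>. measure lborel K *\<^sub>R f x) w - integral (cbox a b) ?\<phi>\<bar>
          = norm (\<Sum>(x, K)\<in>\<D>. measure lborel K * ?\<phi> x - integral K ?\<phi>)"
        by (simp add: inner_sum_left sum_subtractf split_def)
      also have "\<dots> \<le> (\<Sum>(x, K)\<in>\<D>. measure lborel K * (e' * norm w))"
      proof (rule sum_norm_le, safe)
        fix x K
        assume xK: "(x, K) \<in> \<D>"
        have "x \<in> K" and kab: "K \<subseteq> {a..b}"
          using tagged_division_ofD(2,3)[OF \<D> xK] by auto
        obtain u v where k: "K = {u..v}"
          using tagged_division_ofD(4)[OF \<D> xK] by auto
        have "u \<le> v" using \<open>x \<in> K\<close> k by simp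
        have bnd: "\<bar>?\<phi> t - ?\<phi> x\<bar> \<le> e' * norm w" if "t \<in> {u..v}" for t
        proof -
          have "dist t x < d" using fineD[OF fine xK] that k by (auto simp: dist_commute)
          then have "norm (f t - f x) \<le> e'"
            using d(2)[of x t] \<open>x \<in> K\<close> kab that k by (simp add: dist_norm subset_iff)
          then show ?thesis
            using Cauchy_Schwarz_ineq2[of "f t - f x" w] mult_right_mono[of "norm (f t - f x)" e' "norm w"]
            by (simp add: inner_diff_left)
        qed
        have cuv: "continuous_on {u..v} ?\<phi>"
          using cont\<phi> kab k by (metis continuous_on_subset)
        have "norm (integral {u..v} (\<lambda>t. ?\<phi> t - ?\<phi> x)) \<le> (e' * norm w) * (v - u)"
          using bnd \<open>u \<le> v\<close> by (intro integral_bound continuous_on_diff cuv continuous_on_const) auto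
        moreover have "integral {u..v} (\<lambda>t. ?\<phi> t - ?\<phi> x) = integral {u..v} ?\<phi> - (v - u) * ?\<phi> x"
          using \<open>u \<le> v\<close> integrable_continuous_real[OF cuv]
          by (subst Henstock_Kurzweil_Integration.integral_diff) auto
        ultimately show "norm (measure lborel K * ?\<phi> x - integral K ?\<phi>) \<le> measure lborel K * (e' * norm w)"
          using \<open>u \<le> v\<close> by (simp add: k abs_minus_commute mult.commute)
      qed
      also have "\<dots> = (b - a) * (e' * norm w)"
        using additive_content_tagged_division[OF \<D>] True
        by (simp add: split_def flip: sum_distrib_right)
      finally show ?thesis .
    qed
    show "\<exists>\<gamma>. gauge \<gamma> \<and>
          (\<forall>\<D>1 \<D>2. \<D>1 tagged_division_of (cbox a b) \<and> \<gamma> fine \<D>1 \<and>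
            \<D>2 tagged_division_of (cbox a b) \<and> \<gamma> fine \<D>2 \<longrightarrow>
            norm ((\<Sum>(x,K)\<in>\<D>1. measure lborel K *\<^sub>R f x) - (\<Sum>(x,K)\<in>\<D>2. measure lborel K *\<^sub>R f x)) < e)"
    proof (intro exI conjI allI impI)
      show "gauge (\<lambda>x. ball x d)" using d(1) by (simp add: gauge_ball)
    next
      fix \<D>1 \<D>2
      assume asm: "\<D>1 tagged_division_of (cbox a b) \<and> (\<lambda>x. ball x d) fine \<D>1 \<and>
            \<D>2 tagged_division_of (cbox a b) \<and> (\<lambda>x. ball x d) fine \<D>2"
      let ?S = "\<lambda>\<D>. \<Sum>(x,K)\<in>\<D>. measure lborel K *\<^sub>R f x"
      define w where "w = ?S \<D>1 - ?S \<D>2"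
      have "norm w * norm w = inner (?S \<D>1) w - inner (?S \<D>2) w"
        by (simp add: w_def power2_norm_eq_inner inner_diff_left flip: power2_eq_square)
      also have "\<dots> \<le> 2 * ((b - a) * (e' * norm w))"
        using approx[of \<D>1 w] approx[of \<D>2 w] asm unfolding abs_le_iff by linarith
      also have "\<dots> = 2 * (b - a) * e' * norm w" by simp
      finally have "norm w \<le> 2 * (b - a) * e'"
        using True \<open>e' > 0\<close> by (cases "norm w = 0") (auto simp: mult_le_cancel_right)
      then show "norm (?S \<D>1 - ?S \<D>2) < e"
        using e'_le by (simp add: w_def)
    qed
  qed
  then show ?thesis by simp
qed (simp add: integrable_on_empty)

section \<open>Weak limits in Hilbert spaces\<close>

text \<open>Both minimisation arguments below end here. The parallelogram identity produces the
  inequality, with \<open>d\<close> the minimal values and \<open>e\<close> the slack of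
  near-minimisers; a varying \<open>d\<close> serves shrinking sets, a constant one a single
  set.\<close>

lemma Cauchy_if_norm_diff_square_le:
  fixes y :: "nat \<Rightarrow> 'b::real_normed_vector" and d e :: "nat \<Rightarrow> real"
  assumes gap: "\<And>m n. m \<le> n \<Longrightarrow> (norm (y n - y m))\<^sup>2 \<le> 2 * \<bar>d n - d m\<bar> + e m + e n"
    and "convergent d" and "e \<longlonglongrightarrow> 0"
  shows "Cauchy y"
proof (rule metric_CauchyI)
  fix r :: real
  assume "r > 0"
  define r' where "r' = r\<^sup>2 / 8"
  have "r' > 0" using \<open>r > 0\<close> by (simp add: r'_def)
  obtain N1 where N1: "\<And>n. n \<ge> N1 \<Longrightarrow> \<bar>e n\<bar> < r'"
    using LIMSEQ_D[OF \<open>e \<longlonglongrightarrow> 0\<close> \<open>r' > 0\<close>] by auto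
  obtain N2 where N2: "\<And>m n. m \<ge> N2 \<Longrightarrow> n \<ge> N2 \<Longrightarrow> \<bar>d m - d n\<bar> < r'"
    using metric_CauchyD[OF convergent_Cauchy[OF \<open>convergent d\<close>] \<open>r' > 0\<close>]
    by (auto simp: dist_real_def)
  have le: "dist (y m) (y n) < r" if "m \<le> n" "m \<ge> max N1 N2" for m n
  proof -
    have "(norm (y n - y m))\<^sup>2 < r\<^sup>2"
      using gap[OF \<open>m \<le> n\<close>] N1[of m] N1[of n] N2[of n m] that by (simp add: r'_def)
    then show ?thesis
      using \<open>r > 0\<close> by (metis dist_commute dist_norm less_imp_le power2_less_imp_less)
  qed
  show "\<exists>M. \<forall>m\<ge>M. \<forall>n\<ge>M. dist (y m) (y n) < r"
    using le by (metis dist_commute nle_le)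
qed

text \<open>Points \<open>y n\<close> of nearly minimal norm in \<open>K n\<close> converge. The
  infima \<open>d n\<close> increase as the sets shrink and stay bounded; for
  \<open>m \<le> n\<close> both points lie in \<open>K m\<close>, so their midpoint has squared norm
  at least \<open>d m\<close>, and the parallelogram identity bounds their distance.\<close>

lemma nested_closed_convex_nonempty:
  fixes K :: "nat \<Rightarrow> 'b::{real_inner, complete_space} set"
  assumes closed: "\<And>n. closed (K n)" and convex: "\<And>n. convex (K n)"
    and ne: "\<And>n. K n \<noteq> {}" and mono: "\<And>m n. m \<le> n \<Longrightarrow> K n \<subseteq> K m"
    and bdd: "bounded (K 0)"
  shows "\<exists>y. \<forall>n. y \<in> K n"
proof -
  define d where "d n = (INF y\<in>K n. (norm y)\<^sup>2)" for n
  have bb: "bdd_below ((\<lambda>y. (norm y)\<^sup>2) ` K n)" for n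
    by (rule bdd_belowI[of _ 0]) auto
  have dle: "d n \<le> (norm y)\<^sup>2" if "y \<in> K n" for n y
    unfolding d_def by (rule cINF_lower[OF bb that])
  have "\<exists>y\<in>K n. (norm y)\<^sup>2 < d n + inverse (Suc n)" for n
    using cINF_less_iff[OF ne bb, of n "d n + inverse (Suc n)"] by (auto simp: d_def)
  then obtain y where y: "\<And>n. y n \<in> K n" "\<And>n. (norm (y n))\<^sup>2 < d n + inverse (Suc n)"
    by metis
  obtain R where R: "\<And>y. y \<in> K 0 \<Longrightarrow> norm y \<le> R"
    using bdd unfolding bounded_iff by blast
  have dR: "d n \<le> R\<^sup>2" for n
    using dle[OF y(1), of n] R[of "y n"] mono[of 0 n] y(1)[of n]
    by (smt (verit) power_mono norm_ge_zero subsetD zero_le)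
  have "incseq d"
    unfolding d_def by (intro monoI cINF_superset_mono bb ne mono) auto
  then have "convergent d"
    using incseq_convergent[of d "R\<^sup>2"] dR unfolding convergent_def by blast
  have "Cauchy y"
  proof (rule Cauchy_if_norm_diff_square_le[of y d "\<lambda>n. 2 * inverse (Suc n)"])
    fix m n :: nat
    assume "m \<le> n"
    have "d m \<le> (norm (midpoint (y m) (y n)))\<^sup>2"
      using mono[OF \<open>m \<le> n\<close>] y(1)[of m] y(1)[of n] convex[of m]
      by (intro dle) (auto simp: midpoint_def scaleR_right_distrib convex_def)
    moreover have "(norm (y n - y m))\<^sup>2 = 2 * (norm (y m))\<^sup>2 + 2 * (norm (y n))\<^sup>2
            - 4 * (norm (midpoint (y m) (y n)))\<^sup>2"
      by (simp add: midpoint_def power2_norm_eq_inner algebra_simps inner_commute)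
    ultimately show "(norm (y n - y m))\<^sup>2 \<le> 2 * \<bar>d n - d m\<bar> + 2 * inverse (Suc m) + 2 * inverse (Suc n)"
      using y(2)[of m] y(2)[of n] by (smt (verit))
  next
    show "(\<lambda>n. 2 * inverse (real (Suc n))) \<longlonglongrightarrow> 0"
      using tendsto_mult_right_zero[OF LIMSEQ_inverse_real_of_nat] .
  qed fact
  then obtain l where l: "y \<longlonglongrightarrow> l"
    using Cauchy_convergent convergent_def by blast
  have "l \<in> K n" for n
  proof (rule closed_sequentially[OF closed])
    show "y (k + n) \<in> K n" for k using y(1)[of "k + n"] mono[of n "k + n"] by auto
    show "(\<lambda>k. y (k + n)) \<longlonglongrightarrow> l" using l by (rule LIMSEQ_ignore_initial_segment)
  qed
  then show ?thesis by blast
qed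

text \<open>
  A substitute for weak compactness: if the weak limit failed in a direction \<open>y\<close>, the hulls of the
  tails of the offending times would have a common point other than \<open>w\<close>.
\<close>

lemma weakly_tendsto_of_hull_limits:
  fixes f :: "real \<Rightarrow> 'b::{real_inner, complete_space}"
  assumes bdd: "bounded (f ` {T0..})"
    and uniq: "\<And>u v. \<lbrakk>\<And>T. u \<in> closure (convex hull (f ` {T..})); \<And>T. v \<in> closure (convex hull (f ` {T..}))\<rbrakk> \<Longrightarrow> u = v"
  obtains w where "\<And>T. w \<in> closure (convex hull (f ` {T..}))" "weakly_tendsto f w at_top"
proof -
  \<comment> \<open>\<open>S\<close> is any unbounded set of times: \<open>UNIV\<close> yields the
    candidate \<open>w\<close>, the times violating the limit yield the second common point.\<close>
  have nested: "\<exists>u. \<forall>T. u \<in> closure (convex hull (f ` (S \<inter> {T..})))"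
    if S: "\<And>T. \<exists>t\<in>S. t \<ge> T" for S
  proof -
    let ?K = "\<lambda>n::nat. closure (convex hull (f ` (S \<inter> {T0 + n..})))"
    have "\<exists>y. \<forall>n. y \<in> ?K n"
    proof (rule nested_closed_convex_nonempty)
      show "?K n \<noteq> {}" for n
        using S[of "T0 + n"] by auto
      show "?K n \<subseteq> ?K m" if "m \<le> n" for m n
        using that by (intro closure_mono hull_mono) auto
      show "bounded (?K 0)"
        using bdd by (intro bounded_closure bounded_convex_hull) (auto intro: bounded_subset)
    qed (auto intro: convex_closure)
    then obtain y where y: "\<And>n. y \<in> ?K n" by blast
    have "y \<in> closure (convex hull (f ` (S \<inter> {T..})))" for T
    proof -
      obtain n :: nat where "T \<le> T0 + n" using real_arch_simple[of "T - T0"] by (auto simp: algebra_simps)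
      then show ?thesis
        using y[of n] by (rule_tac subsetD[OF closure_mono[OF hull_mono]]) auto
    qed
    then show ?thesis by blast
  qed
  obtain w where w: "\<And>T. w \<in> closure (convex hull (f ` {T..}))"
    using nested[of UNIV] by (auto intro: exI[of _ "_::real"])
  have upper: "eventually (\<lambda>t. inner (f t) y < inner w y + e) at_top" if "e > 0" for y e
  proof (rule ccontr)
    define S where "S = {t. inner (f t) y \<ge> inner w y + e}"
    assume "\<not> eventually (\<lambda>t. inner (f t) y < inner w y + e) at_top"
    then have "\<exists>t\<in>S. t \<ge> T" for T
      by (auto simp: S_def eventually_at_top_linorder not_less)
    then obtain u where u: "\<And>T. u \<in> closure (convex hull (f ` (S \<inter> {T..})))"
      using nested[of S] by blast
    have "u \<in> closure (convex hull (f ` {T..}))" for T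
      by (rule subsetD[OF closure_mono[OF hull_mono] u[of T]]) auto
    then have "u = w" using uniq w by blast
    have "closure (convex hull (f ` (S \<inter> {T0..}))) \<subseteq> {v. inner y v \<ge> inner w y + e}"
      by (intro closure_minimal hull_minimal convex_halfspace_ge closed_halfspace_ge)
         (auto simp: S_def inner_commute)
    with u[of T0] \<open>u = w\<close> \<open>e > 0\<close> show False by (auto simp: inner_commute)
  qed
  have "((\<lambda>t. inner (f t) y) \<longlongrightarrow> inner w y) at_top" for y
  proof (rule tendstoI)
    fix e :: real assume "e > 0"
    show "eventually (\<lambda>t. dist (inner (f t) y) (inner w y) < e) at_top"
      using upper[OF \<open>e > 0\<close>, of y] upper[OF \<open>e > 0\<close>, of "- y"]
      by eventually_elim (auto simp: dist_real_def abs_less_iff)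
  qed
  with w show thesis by (intro that[of w]) (auto simp: weakly_tendsto_def)
qed

text \<open>A tail of \<open>f\<close>, and with it the closed convex hull of that tail, lies in a
  closed half-space. Estimates along the averages thus reach every candidate limit before weak
  convergence is known.\<close>

lemma closure_hull_inner_le:
  assumes "eventually (\<lambda>t. inner (f t) d \<le> c) at_top"
    and u: "\<And>T::real. u \<in> closure (convex hull (f ` {T..}))"
  shows "inner u d \<le> c"
proof -
  obtain T where T: "\<And>t. T \<le> t \<Longrightarrow> inner (f t) d \<le> c"
    using assms(1) unfolding eventually_at_top_linorder by blast
  have "closure (convex hull (f ` {T..})) \<subseteq> {y. inner d y \<le> c}"
    by (intro closure_minimal hull_minimal convex_halfspace_le closed_halfspace_le)
       (use T in \<open>auto simp: inner_commute\<close>)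
  with u[of T] show ?thesis by (auto simp: inner_commute)
qed

section \<open>Monotone operators\<close>

lemma cocoercive_lipschitz:
  assumes "cocoercive \<gamma> M" and "\<gamma> > 0"
  shows "norm (M x - M y) \<le> norm (x - y) / \<gamma>"
proof -
  have "\<gamma> * (norm (M x - M y))\<^sup>2 \<le> inner (x - y) (M x - M y)"
    using assms(1) by (simp add: cocoercive_def)
  also have "\<dots> \<le> norm (x - y) * norm (M x - M y)" by (rule norm_cauchy_schwarz)
  finally have "\<gamma> * norm (M x - M y) * norm (M x - M y) \<le> norm (x - y) * norm (M x - M y)"
    by (simp add: power2_eq_square mult.assoc)
  then have "\<gamma> * norm (M x - M y) \<le> norm (x - y)"
    by (cases "norm (M x - M y) = 0") (auto simp: mult_le_cancel_right)
  then show ?thesis using \<open>\<gamma> > 0\<close> by (simp add: field_simps)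
qed

lemma cocoercive_continuous:
  assumes "cocoercive \<gamma> M" and "\<gamma> > 0"
  shows "continuous_on S M"
proof (rule continuous_on_subset[OF _ subset_UNIV])
  have "(1/\<gamma>)-lipschitz_on UNIV M"
    using cocoercive_lipschitz[OF assms] assms(2) by (intro lipschitz_onI) (auto simp: dist_norm)
  then show "continuous_on UNIV M" by (rule lipschitz_on_continuous_on)
qed

lemma monotone_opD:
  "monotone_op M \<Longrightarrow> b \<in> M a \<Longrightarrow> b' \<in> M a' \<Longrightarrow> inner (a - a') (b - b') \<ge> 0"
  unfolding monotone_op_def op_graph_def by blast

text \<open>Otherwise the graph could be enlarged by the single pair \<open>(x, y)\<close>.\<close>

lemma maximally_monotoneD:
  assumes "maximally_monotone M" and rel: "\<And>u v. v \<in> M u \<Longrightarrow> inner (x - u) (y - v) \<ge> 0"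
  shows "y \<in> M x"
proof (rule ccontr)
  assume "y \<notin> M x"
  define N where "N = (\<lambda>z. if z = x then insert y (M z) else M z)"
  have graph: "op_graph N = insert (x, y) (op_graph M)"
    by (auto simp: op_graph_def N_def split: if_splits)
  have mono: "inner (a - a') (b - b') \<ge> 0" if "b \<in> M a" "b' \<in> M a'" for a a' b b'
    using assms(1) that monotone_opD unfolding maximally_monotone_def by blast
  have "inner (u - x) (v - y) \<ge> 0" if "v \<in> M u" for u v
    using rel[OF that] by (simp add: inner_diff_left inner_diff_right)
  then have "monotone_op N"
    unfolding monotone_op_def graph using rel mono by (auto simp: op_graph_def)
  moreover have "op_graph M \<subset> op_graph N"
    using graph \<open>y \<notin> M x\<close> by (auto simp: op_graph_def)
  ultimately show False using assms(1) by (auto simp: maximally_monotone_def)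
qed

text \<open>
  The minimised function is \<open>r + \<parallel>y\<parallel>\<^sup>2 / 2\<close> over the closed convex hull of the points
  \<open>((a, b), \<langle>a, b\<rangle>)\<close>. Monotonicity bounds it below by \<open>\<parallel>a + b\<parallel>\<^sup>2 / 2\<close>, and the optimality
  condition at the minimiser \<open>((a, b), r)\<close> says that \<open>(- b, - a)\<close> is monotonically related
  to the graph.
\<close>

lemma minty_graph:
  fixes G :: "('b::{real_inner, complete_space} \<times> 'b) set"
  assumes mono: "\<And>a b a' b'. (a, b) \<in> G \<Longrightarrow> (a', b') \<in> G \<Longrightarrow> inner (a - a') (b - b') \<ge> 0"
    and max: "\<And>x y. (\<And>a b. (a, b) \<in> G \<Longrightarrow> inner (x - a) (y - b) \<ge> 0) \<Longrightarrow> (x, y) \<in> G"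
  obtains a where "(a, - a) \<in> G"
proof -
  define lift where "lift y = (y, inner (fst y) (snd y))" for y :: "'b \<times> 'b"
  define Q where "Q = closure (convex hull (lift ` G))"
  define V where "V q = snd q + (norm (fst q))\<^sup>2 / 2" for q :: "('b \<times> 'b) \<times> real"
  have V_pair: "V ((a, b), r) = r + inner a a / 2 + inner b b / 2" for a b r
    by (simp add: V_def power2_norm_eq_inner inner_prod_def add_divide_distrib)
  have "convex Q" "closed Q" unfolding Q_def by (auto intro: convex_closure)
  have lift_Q: "lift y \<in> Q" if "y \<in> G" for y
    using that unfolding Q_def by (meson closure_subset hull_inc imageI subsetD)
  have half: "Q \<subseteq> {q. inner w q \<ge> \<alpha>}" if "\<And>y. y \<in> G \<Longrightarrow> inner w (lift y) \<ge> \<alpha>" for w \<alpha>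
    unfolding Q_def using that
    by (intro closure_minimal hull_minimal convex_halfspace_ge closed_halfspace_ge) auto
  \<comment> \<open>Monotonicity passes to the hull one argument at a time. Here one point is in
    \<open>Q\<close> and the other in \<open>G\<close>; \<open>above\<close> repeats the half-space
    argument in the second slot and then takes both points equal.\<close>
  have pair: "r - inner a b' - inner a' b + inner a' b' \<ge> 0" if "((a, b), r) \<in> Q" "(a', b') \<in> G" for a b r a' b'
  proof -
    have "Q \<subseteq> {q. inner ((- b', - a'), 1) q \<ge> - inner a' b'}"
    proof (rule half)
      fix y assume "y \<in> G"
      then show "inner ((- b', - a'), 1) (lift y) \<ge> - inner a' b'"
        using mono[of "fst y" "snd y" a' b'] \<open>(a', b') \<in> G\<close>
        by (simp add: lift_def inner_prod_def inner_diff_left inner_diff_right inner_commute)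
    qed
    with that(1) show ?thesis by (auto simp: inner_commute)
  qed
  have above: "inner a b \<le> r" if q: "((a, b), r) \<in> Q" for a b r
  proof -
    have "Q \<subseteq> {q. inner ((- b, - a), 1) q \<ge> - r}"
    proof (rule half)
      fix y assume "y \<in> G"
      then show "inner ((- b, - a), 1) (lift y) \<ge> - r"
        using pair[OF q, of "fst y" "snd y"]
        by (simp add: lift_def inner_prod_def inner_commute)
    qed
    with q show ?thesis by (auto simp: inner_commute)
  qed
  have V_nonneg: "(norm (a + b))\<^sup>2 / 2 \<le> V ((a, b), r)" if "((a, b), r) \<in> Q" for a b r
    using above[OF that]
    unfolding V_pair power2_norm_eq_inner inner_add_left inner_add_right inner_commute[of b a]
    by (simp add: add_divide_distrib)
  have "G \<noteq> {}" using max by blast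
  then have "Q \<noteq> {}" using lift_Q by blast
  define v where "v = (INF q\<in>Q. V q)"
  have bb: "bdd_below (V ` Q)"
  proof (rule bdd_belowI[of _ 0])
    fix x assume "x \<in> V ` Q"
    then obtain q where "q \<in> Q" "x = V q" by blast
    moreover obtain a b r where "q = ((a, b), r)" by (metis surj_pair)
    ultimately have "(norm (a + b))\<^sup>2 / 2 \<le> x" using V_nonneg by blast
    then show "0 \<le> x" using zero_le_power2[of "norm (a + b)"] by linarith
  qed
  have v_le: "v \<le> V q" if "q \<in> Q" for q
    unfolding v_def by (rule cINF_lower[OF bb that])
  have "\<exists>q. q \<in> Q \<and> V q < v + inverse (Suc n)" for n
    using cINF_less_iff[OF \<open>Q \<noteq> {}\<close> bb, of "v + inverse (Suc n)"] by (auto simp: v_def)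
  then have "\<exists>q. \<forall>n. q n \<in> Q \<and> V (q n) < v + inverse (Suc n)" by (intro choice) blast
  then obtain q where q: "\<And>n. q n \<in> Q" "\<And>n. V (q n) < v + inverse (Suc n)"
    by blast
  define y where "y n = fst (q n)" for n
  \<comment> \<open>\<open>V\<close> is quadratic in the pair but linear in the real component, so
    the midpoint identity controls only \<open>y\<close>; the real components converge afterwards
    because the values \<open>V (q n)\<close> do.\<close>
  have "Cauchy y"
  proof (rule Cauchy_if_norm_diff_square_le[of y "\<lambda>_. 0" "\<lambda>n. 4 * inverse (Suc n)"])
    fix m n :: nat
    have "midpoint (q m) (q n) \<in> Q"
      using \<open>convex Q\<close> q(1) by (auto simp: midpoint_def scaleR_right_distrib convex_def)
    moreover have "(norm (y n - y m))\<^sup>2 = 4 * V (q m) + 4 * V (q n) - 8 * V (midpoint (q m) (q n))"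
      by (simp add: y_def V_def midpoint_def power2_norm_eq_inner algebra_simps inner_commute)
    ultimately show "(norm (y n - y m))\<^sup>2 \<le> 2 * \<bar>0 - 0\<bar> + 4 * inverse (Suc m) + 4 * inverse (Suc n)"
      using q(2)[of m] q(2)[of n] v_le[of "midpoint (q m) (q n)"] by simp
  next
    show "(\<lambda>n. 4 * inverse (real (Suc n))) \<longlonglongrightarrow> 0"
      using tendsto_mult_right_zero[OF LIMSEQ_inverse_real_of_nat] .
  qed (rule convergent_const)
  then obtain l where l: "y \<longlonglongrightarrow> l"
    using Cauchy_convergent convergent_def by blast
  have "(\<lambda>n. V (q n)) \<longlonglongrightarrow> v"
  proof (rule tendsto_sandwich[OF _ _ tendsto_const])
    show "\<forall>\<^sub>F n in sequentially. V (q n) \<le> v + inverse (real (Suc n))"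
      using q(2) by (intro always_eventually allI less_imp_le)
    show "\<forall>\<^sub>F n in sequentially. v \<le> V (q n)"
      by (intro always_eventually allI v_le q(1))
    show "(\<lambda>n. v + inverse (real (Suc n))) \<longlonglongrightarrow> v"
      using tendsto_add[OF tendsto_const LIMSEQ_inverse_real_of_nat, of v] by simp
  qed
  then have "(\<lambda>n. V (q n) - (norm (y n))\<^sup>2 / 2) \<longlonglongrightarrow> v - (norm l)\<^sup>2 / 2"
    using l by (intro tendsto_intros) auto
  then have "(\<lambda>n. snd (q n)) \<longlonglongrightarrow> v - (norm l)\<^sup>2 / 2"
    by (simp add: V_def y_def)
  with l have "q \<longlonglongrightarrow> (l, v - (norm l)\<^sup>2 / 2)"
    using tendsto_Pair[of y l sequentially "\<lambda>n. snd (q n)"] by (simp add: y_def)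
  then have "(l, v - (norm l)\<^sup>2 / 2) \<in> Q"
    using closed_sequentially[OF \<open>closed Q\<close>] q(1) by blast
  moreover obtain a b where ab: "l = (a, b)" by fastforce
  moreover define r where "r = v - (norm l)\<^sup>2 / 2"
  ultimately have lQ: "((a, b), r) \<in> Q" and Vl: "V ((a, b), r) = v" by (simp_all add: V_def)
  have rel: "inner (- b - a') (- a - b') \<ge> (norm (a + b))\<^sup>2" if ab': "(a', b') \<in> G" for a' b'
  proof -
    define p s where "p = a' - a" and "s = b' - b"
    \<comment> \<open>\<open>X\<close> is the directional derivative of \<open>V\<close> at the
      minimiser towards \<open>lift (a', b')\<close>; \<open>t * Y / 2\<close> is the second-order
      remainder after division by \<open>t\<close>.\<close>
    define X where "X = inner a' b' - r + inner a p + inner b s"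
    define Y where "Y = (norm p)\<^sup>2 + (norm s)\<^sup>2"
    have "Y \<ge> 0" by (simp add: Y_def)
    have step: "0 \<le> X + t * Y / 2" if t: "0 < t" "t \<le> 1" for t
    proof -
      have "(1 - t) *\<^sub>R ((a, b), r) + t *\<^sub>R lift (a', b')
          = ((a + t *\<^sub>R p, b + t *\<^sub>R s), r + t * (inner a' b' - r))"
        by (simp add: lift_def p_def s_def algebra_simps)
      moreover have "(1 - t) *\<^sub>R ((a, b), r) + t *\<^sub>R lift (a', b') \<in> Q"
        using convexD_alt[OF \<open>convex Q\<close> lQ lift_Q[OF ab'], of t] t by simp
      ultimately have "V ((a, b), r) \<le> V ((a + t *\<^sub>R p, b + t *\<^sub>R s), r + t * (inner a' b' - r))"
        using v_le Vl by metis
      also have "\<dots> = V ((a, b), r) + t * (X + t * Y / 2)"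
        unfolding V_pair X_def Y_def power2_norm_eq_inner
        by (simp add: inner_add_left inner_add_right inner_commute[of p a] inner_commute[of s b]
            field_simps)
      finally show ?thesis using t(1) by (simp add: zero_le_mult_iff)
    qed
    have "X \<ge> 0"
    proof (rule ccontr)
      assume "\<not> X \<ge> 0"
      define t where "t = min 1 (- X / (Y + 1))"
      have t: "0 < t" "t \<le> 1" using \<open>\<not> X \<ge> 0\<close> \<open>Y \<ge> 0\<close> by (auto simp: t_def divide_neg_pos)
      have "t \<le> - X / (Y + 1)" unfolding t_def by (rule min.cobounded2)
      then have "t * (Y + 1) \<le> - X" using \<open>Y \<ge> 0\<close> by (subst (asm) pos_le_divide_eq) simp_all
      then show False using step[OF t] t \<open>\<not> X \<ge> 0\<close> \<open>Y \<ge> 0\<close> mult_nonneg_nonneg[of t Y]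
        by (simp add: algebra_simps)
    qed
    then show ?thesis using V_nonneg[OF lQ]
      by (simp add: X_def p_def s_def V_pair power2_norm_eq_inner algebra_simps inner_commute)
  qed
  have mem: "(- b, - a) \<in> G"
    using rel by (intro max) (meson order_trans zero_le_power2)
  \<comment> \<open>The new graph point is inserted into its own inequality, whose inner product
    then vanishes; so \<open>b = - a\<close>, and the point is \<open>(a, - a)\<close>.\<close>
  from rel[OF this] have "a + b = 0" by simp
  then have "- a = b" by (rule minus_unique)
  then have "(a, - a) \<in> G" using mem by (metis minus_minus)
  then show thesis by (rule that)
qed

lemma minty:
  fixes M :: "'b::{real_inner, complete_space} operator"
  assumes "maximally_monotone M" and "c > 0"
  obtains u m where "m \<in> M u" "m + c *\<^sub>R u = q"
proof -
  \<comment> \<open>The graph of \<open>M\<close> after subtracting \<open>q\<close> and dividing by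
    \<open>c\<close>; a point \<open>(a, - a)\<close> of it says that
    \<open>q - c *\<^sub>R a\<close> lies in \<open>M a\<close>.\<close>
  define G where "G = {(a, b). c *\<^sub>R b + q \<in> M a}"
  obtain a where "(a, - a) \<in> G"
  proof (rule minty_graph[of G])
    fix a b a' b' assume "(a, b) \<in> G" "(a', b') \<in> G"
    then have "0 \<le> inner (a - a') ((c *\<^sub>R b + q) - (c *\<^sub>R b' + q))"
      using assms(1) monotone_opD unfolding maximally_monotone_def G_def by blast
    also have "\<dots> = c * inner (a - a') (b - b')" by (simp add: algebra_simps)
    finally show "0 \<le> inner (a - a') (b - b')" using \<open>c > 0\<close> by (simp add: zero_le_mult_iff)
  next
    fix x y assume *: "\<And>a b. (a, b) \<in> G \<Longrightarrow> 0 \<le> inner (x - a) (y - b)"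
    have "c *\<^sub>R y + q \<in> M x"
    proof (rule maximally_monotoneD[OF assms(1)])
      fix u v assume "v \<in> M u"
      then have "(u, (v - q) /\<^sub>R c) \<in> G" using \<open>c > 0\<close> by (simp add: G_def)
      from *[OF this] have "0 \<le> c * inner (x - u) (y - (v - q) /\<^sub>R c)" using \<open>c > 0\<close> by simp
      also have "\<dots> = inner (x - u) (c *\<^sub>R y + q - v)"
      proof -
        have "c *\<^sub>R (y - (v - q) /\<^sub>R c) = c *\<^sub>R y + q - v"
          using \<open>c > 0\<close> by (simp add: scaleR_diff_right)
        then show ?thesis by (metis inner_scaleR_right)
      qed
      finally show "0 \<le> inner (x - u) (c *\<^sub>R y + q - v)" .
    qed
    then show "(x, y) \<in> G" by (simp add: G_def)
  qed
  then show thesis using that[of "c *\<^sub>R (- a) + q" a] by (simp add: G_def)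
qed

text \<open>Minty's theorem solves \<open>m + c *\<^sub>R u = c *\<^sub>R z - D z\<close> with
  \<open>m\<close> in \<open>M u\<close>. The relation at this \<open>u\<close> bounds
  \<open>c\<close> times the squared distance of \<open>u\<close> and \<open>z\<close> by
  \<open>L\<close> times the same quantity, and \<open>c > L\<close> forces \<open>u = z\<close>.
  This plays the part of maximality of the sum of \<open>M\<close> and \<open>D\<close>.\<close>

lemma zero_of_maximally_monotone_plus_lipschitz:
  fixes M :: "'b::{real_inner, complete_space} operator" and D :: "'b \<Rightarrow> 'b"
  assumes "maximally_monotone M" and "0 \<le> L"
    and lip: "\<And>x y. norm (D x - D y) \<le> L * norm (x - y)"
    and rel: "\<And>u m. m \<in> M u \<Longrightarrow> inner (u - z) (m + D u) \<ge> 0"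
  shows "- D z \<in> M z"
proof -
  define c where "c = L + 1"
  have "c > 0" using \<open>0 \<le> L\<close> by (simp add: c_def)
  obtain u m where m: "m \<in> M u" "m + c *\<^sub>R u = c *\<^sub>R z - D z"
    using minty[OF assms(1) \<open>c > 0\<close>] by blast
  have m_eq: "m = - D z - c *\<^sub>R (u - z)" using m(2) by (simp add: algebra_simps)
  have "0 \<le> inner (u - z) (D u - D z) - c * (norm (u - z))\<^sup>2"
    using rel[OF m(1)] by (simp add: m_eq power2_norm_eq_inner inner_diff_right inner_add_right)
  moreover have "inner (u - z) (D u - D z) \<le> norm (u - z) * (L * norm (u - z))"
    by (rule order_trans[OF norm_cauchy_schwarz mult_left_mono[OF lip]]) simp
  ultimately have "(norm (u - z))\<^sup>2 \<le> 0"
    by (simp add: c_def power2_eq_square algebra_simps)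
  then have "u = z" by simp
  then show ?thesis using m(1) m_eq by simp
qed

section \<open>Integrals over the half-line\<close>

lemma continuous_on_halfline:
  fixes f :: "real \<Rightarrow> 'b::topological_space"
  assumes "\<And>b. b > 0 \<Longrightarrow> continuous_on {0..b} f"
  shows "continuous_on {0..} f"
  unfolding continuous_on_eq_continuous_within
proof
  fix t :: real assume t: "t \<in> {0..}"
  have "at t within {0..} = at t within {0..t + 1}"
    by (rule at_within_nhd[of t "{..<t + 1}"]) auto
  then show "continuous (at t within {0..}) f"
    using assms[of "t + 1"] t by (simp add: continuous_on_eq_continuous_within)
qed

text \<open>Monotone convergence for the truncations at \<open>a + k\<close>, whose integrals are
  bounded by \<open>M\<close>.\<close>

lemma integrable_on_halfline_nonneg:
  fixes f :: "real \<Rightarrow> real"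
  assumes nonneg: "\<And>t. a \<le> t \<Longrightarrow> 0 \<le> f t"
    and int: "\<And>T. a \<le> T \<Longrightarrow> f integrable_on {a..T}"
    and le: "\<And>T. a \<le> T \<Longrightarrow> integral {a..T} f \<le> M"
  shows "f integrable_on {a..}"
proof -
  let ?f = "\<lambda>(k::nat) t. if t \<in> {..a + k} then f t else 0"
  have eq: "{..a + k} \<inter> {a..} = {a..a + k}" for k by auto
  have 1: "?f k integrable_on {a..}" for k
    unfolding integrable_restrict_Int eq by (rule int) simp
  have 2: "integral {a..} (?f k) = integral {a..a + k} f" for k
    unfolding integral_restrict_Int eq ..
  have "f integrable_on {a..} \<and> (\<lambda>k. integral {a..} (?f k)) \<longlonglongrightarrow> integral {a..} f"
  proof (rule monotone_convergence_increasing)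
    show "?f k t \<le> ?f (Suc k) t" if "t \<in> {a..}" for k t
      using nonneg[of t] that by simp
    show "(\<lambda>k. ?f k t) \<longlonglongrightarrow> f t" for t
    proof (rule tendsto_eventually)
      obtain n :: nat where "t - a \<le> n" using real_arch_simple by blast
      then show "eventually (\<lambda>k. ?f k t = f t) sequentially"
        by (intro eventually_sequentiallyI[of n]) (auto simp: algebra_simps)
    qed
    show "bounded (range (\<lambda>k. integral {a..} (?f k)))"
    proof (rule boundedI)
      fix r assume "r \<in> range (\<lambda>k. integral {a..} (?f k))"
      then obtain k :: nat where "r = integral {a..a + k} f" using 2 by auto
      moreover have "0 \<le> integral {a..a + k} f"
        using nonneg by (intro integral_nonneg int) auto
      ultimately show "norm r \<le> M" using le[of "a + k"] by simp
    qed
  qed (rule 1)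
  then show ?thesis by blast
qed

lemma integrable_on_halfline_subinterval:
  fixes f :: "real \<Rightarrow> real"
  assumes "f integrable_on {a..}" and "a \<le> s"
  shows "f integrable_on {s..t}"
  by (rule integrable_on_subinterval[OF assms(1)]) (use assms(2) in auto)

lemma integral_subinterval_le_halfline:
  fixes f :: "real \<Rightarrow> real"
  assumes "f integrable_on {a..}" and "\<And>t. a \<le> t \<Longrightarrow> 0 \<le> f t" and "a \<le> s"
  shows "integral {s..t} f \<le> integral {a..} f"
  using assms by (intro integral_subset_le integrable_on_halfline_subinterval) auto

lemma integral_halfline_tail:
  fixes f :: "real \<Rightarrow> real"
  assumes int: "f integrable_on {a..}" and nonneg: "\<And>t. a \<le> t \<Longrightarrow> 0 \<le> f t" and "e > 0"
  obtains T where "a \<le> T" "\<And>t. T \<le> t \<Longrightarrow> integral {T..t} f \<le> e"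
proof -
  let ?F = "\<lambda>t. integral {a..t} f"
  have bdd: "bdd_above (?F ` {a..})"
    by (rule bdd_aboveI[of _ "integral {a..} f"])
       (use integral_subinterval_le_halfline[OF int nonneg] in auto)
  define S where "S = (SUP t\<in>{a..}. ?F t)"
  obtain T where T: "a \<le> T" "S - e < ?F T"
    using less_cSUP_iff[OF _ bdd, of "S - e"] \<open>e > 0\<close> by (auto simp: S_def)
  have "integral {T..t} f \<le> e" if "T \<le> t" for t
  proof -
    have "?F T + integral {T..t} f = ?F t"
      using T(1) that integrable_on_halfline_subinterval[OF int]
      by (intro Henstock_Kurzweil_Integration.integral_combine) auto
    moreover have "?F t \<le> S"
      unfolding S_def using T(1) that by (intro cSUP_upper bdd) auto
    ultimately show ?thesis using T(2) by linarith
  qed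
  with T(1) show thesis by (rule that)
qed

lemma filterlim_integral_halfline:
  fixes f :: "real \<Rightarrow> real"
  assumes nonneg: "\<And>t. a \<le> t \<Longrightarrow> 0 \<le> f t"
    and int: "\<And>T. a \<le> T \<Longrightarrow> f integrable_on {a..T}"
    and "\<not> f integrable_on {a..}"
  shows "filterlim (\<lambda>T. integral {a..T} f) at_top at_top"
  unfolding filterlim_at_top
proof
  fix Z :: real
  obtain T where T: "a \<le> T" "Z < integral {a..T} f"
    using integrable_on_halfline_nonneg[OF nonneg int, of Z] assms(3) by (meson not_le)
  have "Z \<le> integral {a..t} f" if "T \<le> t" for t
  proof -
    have "integral {a..T} f \<le> integral {a..t} f"
      using T(1) that nonneg by (intro integral_subset_le int) auto
    with T(2) show ?thesis by linarith
  qed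
  then show "eventually (\<lambda>t. Z \<le> integral {a..t} f) at_top"
    unfolding eventually_at_top_linorder by blast
qed

lemma increasing_bounded_tendsto_at_top:
  fixes F :: "real \<Rightarrow> real"
  assumes mono: "\<And>s t. a \<le> s \<Longrightarrow> s \<le> t \<Longrightarrow> F s \<le> F t" and le: "\<And>t. a \<le> t \<Longrightarrow> F t \<le> M"
  obtains l where "(F \<longlongrightarrow> l) at_top"
proof -
  have bdd: "bdd_above (F ` {a..})" using le by (intro bdd_aboveI[of _ M]) auto
  have "(F \<longlongrightarrow> (SUP t\<in>{a..}. F t)) at_top"
  proof (rule order_tendstoI)
    fix r assume "r < (SUP t\<in>{a..}. F t)"
    then obtain T where "a \<le> T" "r < F T" using less_cSUP_iff[OF _ bdd] by auto
    then show "eventually (\<lambda>t. r < F t) at_top"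
      using mono[of T] unfolding eventually_at_top_linorder by (meson less_le_trans)
  next
    fix r assume "(SUP t\<in>{a..}. F t) < r"
    then show "eventually (\<lambda>t. F t < r) at_top"
      using cSUP_upper[OF _ bdd] unfolding eventually_at_top_linorder
      by (meson atLeast_iff le_less_trans)
  qed
  then show thesis by (rule that)
qed

text \<open>\<open>h\<close> is the difference of two increasing functions bounded above: the
  running integral of \<open>k\<close>, and that integral minus \<open>h\<close>.\<close>

lemma tendsto_of_integrable_increase:
  fixes h k :: "real \<Rightarrow> real"
  assumes h: "\<And>t. a \<le> t \<Longrightarrow> 0 \<le> h t"
    and k: "k integrable_on {a..}" "\<And>t. a \<le> t \<Longrightarrow> 0 \<le> k t"
    and inc: "\<And>s t. a \<le> s \<Longrightarrow> s \<le> t \<Longrightarrow> h t - h s \<le> integral {s..t} k"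
  obtains l where "(h \<longlongrightarrow> l) at_top"
proof -
  let ?K = "\<lambda>t. integral {a..t} k"
  have comb: "?K s + integral {s..t} k = ?K t" if "a \<le> s" "s \<le> t" for s t
    using that integrable_on_halfline_subinterval[OF k(1)]
    by (intro Henstock_Kurzweil_Integration.integral_combine) auto
  have pos: "0 \<le> integral {s..t} k" if "a \<le> s" for s t
    using that k(2) integrable_on_halfline_subinterval[OF k(1)] by (intro integral_nonneg) auto
  have le: "?K t \<le> integral {a..} k" for t
    using k by (intro integral_subinterval_le_halfline) auto
  obtain l1 where l1: "(?K \<longlongrightarrow> l1) at_top"
  proof (rule increasing_bounded_tendsto_at_top[of a ?K])
    show "?K s \<le> ?K t" if "a \<le> s" "s \<le> t" for s t
      using comb[OF that] pos[OF that(1), of t] by linarith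
  qed (rule le)
  obtain l2 where l2: "((\<lambda>t. ?K t - h t) \<longlongrightarrow> l2) at_top"
  proof (rule increasing_bounded_tendsto_at_top[of a "\<lambda>t. ?K t - h t" "integral {a..} k"])
    show "?K s - h s \<le> ?K t - h t" if "a \<le> s" "s \<le> t" for s t
      using comb[OF that] inc[OF that] by linarith
    show "?K t - h t \<le> integral {a..} k" if "a \<le> t" for t
      using le[of t] h[OF that] by linarith
  qed
  have "((\<lambda>t. ?K t - (?K t - h t)) \<longlongrightarrow> l1 - l2) at_top"
    by (intro tendsto_diff l1 l2)
  then show thesis by (intro that[of "l1 - l2"]) simp
qed

text \<open>
  A form of Gronwall's inequality: past a time after which the integral of \<open>m\<close> is at most
  \<open>1/2\<close>, the maximum of \<open>h\<close> on an interval is absorbed into the left-hand side.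
\<close>

lemma bounded_of_integrable_growth:
  fixes h m k :: "real \<Rightarrow> real"
  assumes h: "\<And>t. a \<le> t \<Longrightarrow> 0 \<le> h t" "continuous_on {a..} h"
    and m: "m integrable_on {a..}" "\<And>t. a \<le> t \<Longrightarrow> 0 \<le> m t" "continuous_on {a..} m"
    and k: "k integrable_on {a..}" "\<And>t. a \<le> t \<Longrightarrow> 0 \<le> k t"
    and inc: "\<And>s t. a \<le> s \<Longrightarrow> s \<le> t \<Longrightarrow> h t - h s \<le> integral {s..t} (\<lambda>\<tau>. m \<tau> * h \<tau> + k \<tau>)"
  obtains M where "\<And>t. a \<le> t \<Longrightarrow> h t \<le> M"
proof -
  obtain T where T: "a \<le> T" "\<And>t. T \<le> t \<Longrightarrow> integral {T..t} m \<le> 1/2"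
    by (rule integral_halfline_tail[OF m(1) m(2), of "1/2"]) auto
  have late: "h t \<le> 2 * (h T + integral {a..} k)" if t: "T \<le> t" for t
  proof -
    have "continuous_on {T..t} h" using h(2) by (rule continuous_on_subset) (use T(1) in auto)
    then obtain \<tau> where \<tau>: "\<tau> \<in> {T..t}" "\<And>s. s \<in> {T..t} \<Longrightarrow> h s \<le> h \<tau>"
      using continuous_attains_sup[of "{T..t}" h] t by auto
    have mi: "m integrable_on {T..\<tau>}" and ki: "k integrable_on {T..\<tau>}"
      using T(1) m(1) k(1) by (auto intro: integrable_on_halfline_subinterval)
    have "continuous_on {T..\<tau>} (\<lambda>s. m s * h s)"
      by (rule continuous_on_subset[OF continuous_on_mult[OF m(3) h(2)]]) (use T(1) in auto)
    then have mhi: "(\<lambda>s. m s * h s) integrable_on {T..\<tau>}"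
      by (rule integrable_continuous_real)
    have "h \<tau> - h T \<le> integral {T..\<tau>} (\<lambda>s. m s * h s + k s)"
      using inc[of T \<tau>] T(1) \<tau>(1) by auto
    also have "\<dots> \<le> integral {T..\<tau>} (\<lambda>s. m s * h \<tau> + k s)"
      using mi mhi ki m(2) \<tau> T(1)
      by (intro integral_le integrable_add integrable_on_mult_left add_right_mono mult_left_mono) auto
    also have "\<dots> = integral {T..\<tau>} m * h \<tau> + integral {T..\<tau>} k"
      using mi ki by (simp add: Henstock_Kurzweil_Integration.integral_add integrable_on_mult_left)
    also have "\<dots> \<le> 1/2 * h \<tau> + integral {a..} k"
      using T \<tau>(1) h(1)[of \<tau>] k
      by (intro add_mono mult_right_mono integral_subinterval_le_halfline) auto
    finally have "h \<tau> \<le> 2 * (h T + integral {a..} k)" by (simp add: field_simps)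
    then show ?thesis using \<tau>(2)[of t] t by fastforce
  qed
  have "continuous_on {a..T} h" using h(2) by (rule continuous_on_subset) auto
  then have "\<exists>\<tau>\<in>{a..T}. \<forall>s\<in>{a..T}. h s \<le> h \<tau>"
    using continuous_attains_sup[of "{a..T}" h] T(1) by simp
  then obtain \<tau> where \<tau>: "\<And>s. s \<in> {a..T} \<Longrightarrow> h s \<le> h \<tau>" by blast
  have "h t \<le> max (h \<tau>) (2 * (h T + integral {a..} k))" if "a \<le> t" for t
    using late[of t] \<tau>[of t] that by (cases "t \<le> T") auto
  then show thesis by (rule that)
qed

lemma has_integral_le_off_negligible:
  fixes f g :: "real \<Rightarrow> real"
  assumes "(f has_integral i) S" "(g has_integral j) S" "negligible N"
    and le: "\<And>t. t \<in> S - N \<Longrightarrow> f t \<le> g t"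
  shows "i \<le> j"
proof (rule has_integral_le)
  show "((\<lambda>t. if t \<in> N then 0 else f t) has_integral i) S"
    by (rule has_integral_spike[OF assms(3) _ assms(1)]) simp
  show "((\<lambda>t. if t \<in> N then 0 else g t) has_integral j) S"
    by (rule has_integral_spike[OF assms(3) _ assms(2)]) simp
qed (use le in auto)

lemma integrable_on_halfline_bounded_by:
  fixes f g :: "real \<Rightarrow> real"
  assumes f: "\<And>T. a \<le> T \<Longrightarrow> f integrable_on {a..T}" "\<And>t. a \<le> t \<Longrightarrow> 0 \<le> f t"
    and g: "g integrable_on {a..}" "\<And>t. a \<le> t \<Longrightarrow> f t \<le> g t"
  shows "f integrable_on {a..}"
proof (rule integrable_on_halfline_nonneg[OF f(2) f(1)])
  fix T assume "a \<le> T"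
  then have "integral {a..T} f \<le> integral {a..T} g"
    using g by (intro integral_le f integrable_on_halfline_subinterval) auto
  also have "\<dots> \<le> integral {a..} g"
    using f(2) g by (intro integral_subinterval_le_halfline) (auto intro: order_trans)
  finally show "integral {a..T} f \<le> integral {a..} g" .
qed

lemma integrable_on_halfline_extend:
  fixes f :: "real \<Rightarrow> real"
  assumes "f integrable_on {a..b}" "f integrable_on {b..}" "a \<le> b"
  shows "f integrable_on {a..}"
proof -
  have "f integrable_on {a..b} \<union> {b..}"
  proof (rule integrable_Un)
    have "{a..b} \<inter> {b..} = {b}" using assms(3) by auto
    then show "negligible ({a..b} \<inter> {b..})" by simp
  qed (use assms in auto)
  also have "{a..b} \<union> {b..} = {a..}" using assms(3) by auto
  finally show ?thesis .
qed

section \<open>The penalised flow\<close>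

lemma inner_le_young:
  fixes a b :: "'a::real_inner"
  assumes "0 < c"
  shows "inner a b \<le> c * (norm a)\<^sup>2 + (norm b)\<^sup>2 / (4 * c)"
proof -
  have "inner a b \<le> norm a * norm b" by (rule norm_cauchy_schwarz)
  also have "\<dots> = c * (norm a)\<^sup>2 + (norm b)\<^sup>2 / (4 * c) - (2 * c * norm a - norm b)\<^sup>2 / (4 * c)"
    using assms by (simp add: power2_eq_square field_simps)
  also have "\<dots> \<le> c * (norm a)\<^sup>2 + (norm b)\<^sup>2 / (4 * c)" using assms by simp
  finally show ?thesis .
qed

text \<open>One setting for both cases: \<open>\<gamma> = 0\<close> is plain monotonicity,
  \<open>\<gamma> > 0\<close> strong monotonicity. The resolvent equation appears as the inclusion
  it encodes, and absolute continuity as the dominating density in \<open>dom\<close>. The velocity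
  is 0 on the null set \<open>N\<close>, so that pointwise bounds on \<open>norm (v t)\<close> can
  hold at every time.\<close>

locale penalty_flow =
  fixes A :: "'a::{real_inner, complete_space} operator" and D B :: "'a \<Rightarrow> 'a"
    and \<gamma> \<eta> \<mu> :: real and lam bet :: "real \<Rightarrow> real"
    and x v :: "real \<Rightarrow> 'a" and N :: "real set"
  assumes A_mono: "\<And>y a y' a'. a \<in> A y \<Longrightarrow> a' \<in> A y' \<Longrightarrow> inner (y - y') (a - a') \<ge> \<gamma> * (norm (y - y'))\<^sup>2"
    and \<gamma>_nonneg: "0 \<le> \<gamma>"
    and \<eta>_pos: "0 < \<eta>" and D_coco: "cocoercive \<eta> D"
    and \<mu>_pos: "0 < \<mu>" and B_coco: "cocoercive \<mu> B"
    and lam_pos: "\<And>t. 0 \<le> t \<Longrightarrow> 0 < lam t" and lam_cont: "continuous_on {0..} lam"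
    and bet_pos: "\<And>t. 0 \<le> t \<Longrightarrow> 0 < bet t" and bet_cont: "continuous_on {0..} bet"
    and lam_sq: "(\<lambda>t. (lam t)\<^sup>2) integrable_on {0..}"
    and lam_not: "\<not> lam integrable_on {0..}"
    and step_bound: "eventually (\<lambda>t. lam t * bet t \<le> 2 * \<mu>) at_top"
    and negl: "negligible N" and v_null: "\<And>t. t \<in> N \<Longrightarrow> v t = 0"
    and x_der: "\<And>t. t \<in> {0..} - N \<Longrightarrow> (x has_vector_derivative v t) (at t within {0..})"
    and incl: "\<And>t. t \<in> {0..} - N \<Longrightarrow>
      \<exists>a\<in>A (v t + x t). v t = - (lam t *\<^sub>R (a + D (x t) + bet t *\<^sub>R B (x t)))"
    and dom: "\<And>b. 0 \<le> b \<Longrightarrow> \<exists>g. g integrable_on {0..b} \<and> (\<forall>t. 0 \<le> g t) \<and>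
      (\<forall>s t. 0 \<le> s \<longrightarrow> s \<le> t \<longrightarrow> t \<le> b \<longrightarrow> norm (x t - x s) \<le> integral {s..t} g)"
begin

section \<open>Regularity of the trajectory and of its velocity\<close>

lemma x_cont: "continuous_on {0..} x"
proof (rule continuous_on_halfline)
  fix b :: real assume "b > 0"
  then obtain g where g: "g integrable_on {0..b}" "\<And>t. 0 \<le> g t"
    "\<And>s t. 0 \<le> s \<Longrightarrow> s \<le> t \<Longrightarrow> t \<le> b \<Longrightarrow> norm (x t - x s) \<le> integral {s..t} g"
    using dom[of b] by auto
  let ?F = "\<lambda>t. integral {0..t} g"
  have F: "norm (x t - x s) \<le> \<bar>?F t - ?F s\<bar>" if "0 \<le> s" "s \<le> t" "t \<le> b" for s t
  proof -
    have "?F s + integral {s..t} g = ?F t"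
      using that integrable_subinterval_real[OF g(1)]
      by (intro Henstock_Kurzweil_Integration.integral_combine) auto
    then show ?thesis using g(3)[OF that] by linarith
  qed
  have F2: "dist (x t) (x s) \<le> dist (?F t) (?F s)" if "s \<in> {0..b}" "t \<in> {0..b}" for s t
    using F[of s t] F[of t s] that by (cases "s \<le> t") (auto simp: dist_norm dist_commute norm_minus_commute abs_minus_commute)
  have "continuous_on {0..b} ?F" by (rule indefinite_integral_continuous_1[OF g(1)])
  then show "continuous_on {0..b} x"
    unfolding continuous_on_iff using F2 by (meson le_less_trans)
qed

lemma D_cont: "continuous_on {0..} (\<lambda>t. D (x t))"
  by (rule continuous_on_compose2[OF cocoercive_continuous[OF D_coco \<eta>_pos, of UNIV] x_cont]) simp

lemma B_cont: "continuous_on {0..} (\<lambda>t. B (x t))"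
  by (rule continuous_on_compose2[OF cocoercive_continuous[OF B_coco \<mu>_pos, of UNIV] x_cont]) simp

lemmas cont = continuous_intros lam_cont bet_cont x_cont D_cont B_cont

lemma integrable_interval:
  fixes f :: "real \<Rightarrow> real"
  assumes "continuous_on {0..} f" and "0 \<le> s"
  shows "f integrable_on {s..t}"
  by (rule integrable_continuous_real[OF continuous_on_subset[OF assms(1)]]) (use assms(2) in auto)

text \<open>Off a null set \<open>v\<close> is the limit of difference quotients of the continuous
  \<open>x\<close>; the forward steps \<open>inverse (Suc n)\<close> stay inside the half-line.
  Measurability is what turns a pointwise majorant of the squared speed into integrability.\<close>

lemma norm_v_measurable: "(\<lambda>t. norm (v t)) \<in> borel_measurable (lebesgue_on {0..})"
proof (rule borel_measurable_lebesgue_on_AE_limit)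
  let ?q = "\<lambda>(n::nat) t. real (Suc n) *\<^sub>R (x (t + inverse (Suc n)) - x t)"
  show "(\<lambda>t. norm (?q n t)) \<in> borel_measurable (lebesgue_on {0..})" for n
  proof (rule continuous_imp_measurable_on_sets_lebesgue)
    have "continuous_on {0..} (\<lambda>t. x (t + inverse (Suc n)))"
      by (rule continuous_on_compose2[OF x_cont]) (auto intro!: continuous_intros)
    then show "continuous_on {0..} (\<lambda>t. norm (?q n t))"
      by (intro continuous_intros x_cont)
  qed simp
  have lim: "(\<lambda>n. norm (?q n t)) \<longlonglongrightarrow> norm (v t)" if t: "t \<in> {0..} - N" for t
  proof -
    have "((\<lambda>y. norm (x y - x t - (y - t) *\<^sub>R v t) / norm (y - t)) \<longlongrightarrow> 0) (at t within {0..})"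
      using x_der[OF t] unfolding has_vector_derivative_def has_derivative_iff_norm by blast
    moreover have "filterlim (\<lambda>n. t + inverse (real (Suc n))) (at t within {0..}) sequentially"
    proof -
      have "(\<lambda>n. t + inverse (real (Suc n))) \<longlonglongrightarrow> t"
        using tendsto_add[OF tendsto_const LIMSEQ_inverse_real_of_nat, of t] by simp
      then show ?thesis
        unfolding filterlim_at using t by (auto intro!: always_eventually)
    qed
    ultimately have "(\<lambda>n. norm (x (t + inverse (Suc n)) - x t - ((t + inverse (Suc n)) - t) *\<^sub>R v t)
        / norm ((t + inverse (real (Suc n))) - t)) \<longlonglongrightarrow> 0"
      by (rule filterlim_compose)
    moreover have "norm (x (t + inverse (Suc n)) - x t - ((t + inverse (Suc n)) - t) *\<^sub>R v t)
        / norm ((t + inverse (real (Suc n))) - t) = norm (?q n t - v t)" for n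
    proof -
      have "?q n t - v t = real (Suc n) *\<^sub>R (x (t + inverse (Suc n)) - x t - inverse (real (Suc n)) *\<^sub>R v t)"
        unfolding scaleR_diff_right scaleR_scaleR by simp
      then show ?thesis by (simp add: divide_inverse mult.commute)
    qed
    ultimately have "(\<lambda>n. ?q n t) \<longlonglongrightarrow> v t"
      by (simp add: tendsto_norm_zero_iff LIM_zero_iff)
    then show ?thesis by (rule tendsto_norm)
  qed
  have "AE t in lebesgue. t \<notin> N"
    using negl by (simp add: negligible_iff_null_sets AE_not_in)
  then have "AE t in lebesgue. t \<in> {0..} \<longrightarrow> (\<lambda>n. norm (?q n t)) \<longlonglongrightarrow> norm (v t)"
    by eventually_elim (use lim in blast)
  then show "AE t in lebesgue_on {0..}. (\<lambda>n. norm (?q n t)) \<longlonglongrightarrow> norm (v t)"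
    by (subst AE_restrict_space_iff) (simp_all del: of_nat_Suc)
qed simp

text \<open>On \<open>{0..t}\<close> the distance to \<open>z\<close> is at most some
  \<open>R\<close>, and a difference of squared norms factors as
  \<open>inner (x t' - x s') ((x t' - z) + (x s' - z))\<close>. Hence \<open>2 * R\<close> times the
  density of \<open>x\<close> dominates the increments of the squared distance.\<close>

lemma energy_has_integral:
  assumes "0 \<le> s" "s \<le> t"
  shows "((\<lambda>\<tau>. 2 * inner (x \<tau> - z) (v \<tau>)) has_integral
    ((norm (x t - z))\<^sup>2 - (norm (x s - z))\<^sup>2)) {s..t}"
proof -
  obtain g where g: "g integrable_on {0..t}" "\<And>t. 0 \<le> g t"
    "\<And>s' t'. 0 \<le> s' \<Longrightarrow> s' \<le> t' \<Longrightarrow> t' \<le> t \<Longrightarrow> norm (x t' - x s') \<le> integral {s'..t'} g"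
    using dom[of t] assms by auto
  have "continuous_on {0..t} (\<lambda>\<tau>. x \<tau> - z)"
    by (intro continuous_intros continuous_on_subset[OF x_cont]) auto
  then have "bounded ((\<lambda>\<tau>. x \<tau> - z) ` {0..t})"
    by (intro compact_imp_bounded compact_continuous_image) auto
  then obtain R where R: "R > 0" "\<And>\<tau>. \<tau> \<in> {0..t} \<Longrightarrow> norm (x \<tau> - z) \<le> R"
    unfolding bounded_pos by auto
  show ?thesis
  proof (rule has_integral_of_dominated_increments[OF assms(2) negl, where \<gamma> = "\<lambda>\<tau>. 2 * R * g \<tau>"])
    fix \<tau> assume \<tau>: "\<tau> \<in> {s..t} - N"
    have "(x has_vector_derivative v \<tau>) (at \<tau> within {s..t})"
      by (rule has_vector_derivative_within_subset[OF x_der]) (use \<tau> assms in auto)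
    then have "((\<lambda>\<tau>. x \<tau> - z) has_vector_derivative v \<tau>) (at \<tau> within {s..t})"
      by (auto intro!: derivative_eq_intros)
    from bounded_bilinear.has_vector_derivative[OF bounded_bilinear_inner this this]
    show "((\<lambda>\<tau>. (norm (x \<tau> - z))\<^sup>2) has_vector_derivative 2 * inner (x \<tau> - z) (v \<tau>)) (at \<tau> within {s..t})"
      by (simp add: power2_norm_eq_inner inner_commute)
  next
    show "(\<lambda>\<tau>. 2 * R * g \<tau>) integrable_on {s..t}"
      using integrable_subinterval_real[OF g(1), of s t] assms by (intro integrable_on_mult_right) auto
  next
    fix s' t' assume st: "s \<le> s'" "s' \<le> t'" "t' \<le> t"
    have "(norm (x t' - z))\<^sup>2 - (norm (x s' - z))\<^sup>2 = inner (x t' - x s') ((x t' - z) + (x s' - z))"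
      by (simp add: power2_norm_eq_inner algebra_simps inner_commute)
    also have "norm \<dots> \<le> norm (x t' - x s') * norm ((x t' - z) + (x s' - z))"
      by (simp add: Cauchy_Schwarz_ineq2)
    also have "\<dots> \<le> integral {s'..t'} g * (2 * R)"
    proof (rule mult_mono)
      show "norm (x t' - x s') \<le> integral {s'..t'} g" using g(3) st assms by simp
      show "norm ((x t' - z) + (x s' - z)) \<le> 2 * R"
        using norm_triangle_ineq[of "x t' - z" "x s' - z"] R(2)[of t'] R(2)[of s'] st assms by force
      show "0 \<le> integral {s'..t'} g"
        using g(2) integrable_subinterval_real[OF g(1), of s' t'] st assms by (intro integral_nonneg) auto
    qed simp
    also have "\<dots> = integral {s'..t'} (\<lambda>\<tau>. 2 * R * g \<tau>)" by simp
    finally show "norm ((norm (x t' - z))\<^sup>2 - (norm (x s' - z))\<^sup>2) \<le> integral {s'..t'} (\<lambda>\<tau>. 2 * R * g \<tau>)" .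
  qed
qed

text \<open>The vector \<open>p\<close> is arbitrary here, as only \<open>p - w\<close>, equal to
  \<open>- (a + D z)\<close>, enters. The two are kept apart because \<open>p\<close> will be
  balanced against \<open>B\<close> while \<open>w\<close> survives as the linear term.\<close>

lemma resolvent_inequality:
  assumes t: "t \<in> {0..} - N" and a: "a \<in> A z" and w: "w = a + D z + p"
  shows "(norm (v t))\<^sup>2 + inner (v t) (x t - z) + lam t * \<gamma> * (norm (v t + x t - z))\<^sup>2
    \<le> lam t * inner (v t + x t - z) (D z - D (x t) - bet t *\<^sub>R B (x t) + p - w)"
proof -
  obtain b where b: "b \<in> A (v t + x t)" "v t = - (lam t *\<^sub>R (b + D (x t) + bet t *\<^sub>R B (x t)))"
    using incl[OF t] by blast
  have "lam t * (\<gamma> * (norm (v t + x t - z))\<^sup>2) \<le> lam t * inner (v t + x t - z) (b - a)"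
    using A_mono[OF b(1) a] lam_pos[of t] t by (intro mult_left_mono) auto
  also have "\<dots> = inner (v t + x t - z) (lam t *\<^sub>R (b + D (x t) + bet t *\<^sub>R B (x t)))
      + lam t * inner (v t + x t - z) (D z - D (x t) - bet t *\<^sub>R B (x t) + p - w)"
    unfolding inner_scaleR_right[symmetric] inner_add_right[symmetric]
    by (simp add: w algebra_simps)
  also have "lam t *\<^sub>R (b + D (x t) + bet t *\<^sub>R B (x t)) = - v t" using b(2) by simp
  also have "inner (v t + x t - z) (- v t) = - ((norm (v t))\<^sup>2 + inner (v t) (x t - z))"
    by (simp add: power2_norm_eq_inner algebra_simps inner_commute)
  finally show ?thesis by (simp add: mult.assoc)
qed

text \<open>Young's inequality with weight 1/2 absorbs half of the squared speed and leaves a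
  continuous majorant. This local fact precedes the energy estimates because the energy inequality
  is integrated term by term.\<close>

lemma norm_v_square_integrable:
  assumes "a \<in> A z" and "0 \<le> T"
  shows "(\<lambda>t. (norm (v t))\<^sup>2) integrable_on {0..T}"
proof -
  define q where "q t = lam t *\<^sub>R (D z - D (x t) - bet t *\<^sub>R B (x t) - (a + D z))" for t
  \<comment> \<open>The absolute value keeps the majorant valid on \<open>N\<close>, where
    \<open>v\<close> is 0.\<close>
  define g where "g t = \<bar>(norm (q t - (x t - z)))\<^sup>2 + 2 * inner (x t - z) (q t)\<bar>" for t
  have "continuous_on {0..} g" unfolding g_def q_def by (intro cont)
  then have g: "g integrable_on {0..T}" using integrable_interval by simp
  have bound: "\<bar>(norm (v t))\<^sup>2\<bar> \<le> g t" if t: "t \<in> {0..T}" for t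
  proof (cases "t \<in> N")
    case True then show ?thesis by (simp add: v_null g_def)
  next
    case False
    have "0 \<le> lam t * \<gamma> * (norm (v t + x t - z))\<^sup>2"
      using lam_pos[of t] t \<gamma>_nonneg by (intro mult_nonneg_nonneg) auto
    then have "(norm (v t))\<^sup>2 + inner (v t) (x t - z) \<le> inner (v t + x t - z) (q t)"
      using resolvent_inequality[of t a z "a + D z" 0] assms(1) t False by (simp add: q_def)
    then have "(norm (v t))\<^sup>2 \<le> inner (v t) (q t - (x t - z)) + inner (x t - z) (q t)"
      by (simp add: algebra_simps)
    then show ?thesis
      using inner_le_young[of "1/2" "v t" "q t - (x t - z)"] unfolding g_def by simp
  qed
  have meas: "(\<lambda>t. (norm (v t))\<^sup>2) \<in> borel_measurable (lebesgue_on {0..T})"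
  proof -
    have "(\<lambda>t. norm (v t)) \<in> borel_measurable (lebesgue_on {0..T})"
      by (rule measurable_restrict_mono[OF norm_v_measurable]) simp
    then show ?thesis by measurable
  qed
  show ?thesis
    by (rule measurable_bounded_by_integrable_imp_integrable_real[OF meas g bound]) simp_all
qed

text \<open>
  Of the dissipation \<open>\<lambda>\<beta> \<langle>B x, x - z\<rangle>\<close>, two thirds absorb \<open>\<lambda>\<beta> \<langle>v, B x\<rangle>\<close>, which uses
  \<open>\<lambda>\<beta> \<le> 2\<mu>\<close>. One sixth is left over, and the last sixth controls \<open>\<lambda> \<langle>x - z, p\<rangle>\<close>: their
  difference is \<open>gap\<close>, which the Fitzpatrick hypothesis for \<open>6 p\<close> makes integrable.
\<close>

definition gap :: "'a \<Rightarrow> 'a \<Rightarrow> real \<Rightarrow> real" where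
  "gap z p t = max 0 (lam t * bet t * inner (z - x t) (B (x t)) / 6 + lam t * inner (x t - z) p)"

text \<open>Twice the coefficients in \<open>e1\<close> and \<open>e5\<close> below. Young's
  inequality with weight 1/32 contributes a factor 8 there: the Lipschitz constant
  \<open>1 / \<eta>\<close> of \<open>D\<close> gives \<open>8 / \<eta>\<^sup>2\<close>, and the
  cross term with coefficient \<open>2 * l * \<gamma>\<close> gives
  \<open>32 * \<gamma>\<^sup>2\<close>.\<close>

definition growth :: real where
  "growth = 16 / \<eta>\<^sup>2 + 64 * \<gamma>\<^sup>2"

lemma B_inner: "B z = 0 \<Longrightarrow> \<mu> * (norm (B y))\<^sup>2 \<le> inner (y - z) (B y)"
  using B_coco unfolding cocoercive_def by (metis diff_zero)

text \<open>The squared speed has coefficient 1 to spend: 3/4 goes to the cross term with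
  \<open>B\<close> and 1/32 to each of the three others. The remaining 5/32 doubles to 5/16, rounded
  down to 1/4.\<close>

lemma energy_inequality:
  assumes t: "t \<in> {0..} - N" and step: "lam t * bet t \<le> 2 * \<mu>"
    and z: "B z = 0" "a \<in> A z" "w = a + D z + p"
  shows "2 * inner (x t - z) (v t) \<le>
    growth * (lam t)\<^sup>2 * (norm (x t - z))\<^sup>2 + (2 * gap z p t + 16 * (norm (p - w))\<^sup>2 * (lam t)\<^sup>2)
    - (norm (v t))\<^sup>2 / 4 - lam t * bet t * inner (B (x t)) (x t - z) / 3
    - 2 * \<gamma> * lam t * (norm (x t - z))\<^sup>2 - 2 * lam t * inner (x t - z) w"
proof -
  define l s y d b where "l = lam t" and "s = lam t * bet t" and "y = x t - z"
    and "d = D z - D (x t)" and "b = B (x t)"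
  let ?V = "(norm (v t))\<^sup>2"
  have lp: "l > 0" "s > 0" using lam_pos[of t] bet_pos[of t] t by (auto simp: l_def s_def)
  have main: "?V + inner (v t) y + l * \<gamma> * (norm (v t + y))\<^sup>2
      \<le> l * inner (v t) d + l * inner y d - s * inner (v t) b - s * inner y b
        + l * inner (v t) (p - w) + l * inner y p - l * inner y w"
    using resolvent_inequality[OF t z(2,3)]
    by (simp add: l_def s_def y_def d_def b_def algebra_simps)
  have e1: "l * inner (v t) d \<le> ?V / 32 + 8 * l\<^sup>2 * (norm y)\<^sup>2 / \<eta>\<^sup>2"
  proof -
    have "norm d \<le> norm y / \<eta>"
      using cocoercive_lipschitz[OF D_coco \<eta>_pos, of z "x t"]
      by (simp add: d_def y_def norm_minus_commute)
    then have "(norm d)\<^sup>2 \<le> (norm y)\<^sup>2 / \<eta>\<^sup>2"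
      using power_mono[of "norm d" "norm y / \<eta>" 2] by (simp add: power_divide)
    then have "8 * l\<^sup>2 * (norm d)\<^sup>2 \<le> 8 * l\<^sup>2 * ((norm y)\<^sup>2 / \<eta>\<^sup>2)"
      by (intro mult_left_mono) auto
    moreover have "l * inner (v t) d \<le> ?V / 32 + 8 * (l\<^sup>2 * (norm d)\<^sup>2)"
      using inner_le_young[of "1/32" "v t" "l *\<^sub>R d"] by (simp add: power_mult_distrib)
    ultimately show ?thesis by simp
  qed
  have e2: "inner y d \<le> 0"
  proof -
    have "0 \<le> \<eta> * (norm (D (x t) - D z))\<^sup>2" using \<eta>_pos by simp
    also have "\<dots> \<le> inner (x t - z) (D (x t) - D z)"
      using D_coco by (simp add: cocoercive_def)
    also have "\<dots> = - inner y d" by (simp add: y_def d_def inner_diff_right)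
    finally show ?thesis by simp
  qed
  \<comment> \<open>Since \<open>s \<le> 2 * \<mu>\<close>, a Young weight c costs the share c of
    the squared speed and the share 1/(2c) of the dissipation. Both stay below 1 for c strictly
    between 1/2 and 1; the weight 3/4 gives 3/4 and 2/3.\<close>
  have e3: "- (s * inner (v t) b) \<le> 3/4 * ?V + 2/3 * (s * inner y b)"
  proof -
    have "- (s * inner (v t) b) \<le> 3/4 * ?V + s\<^sup>2 * (norm b)\<^sup>2 / 3"
      using inner_le_young[of "3/4" "v t" "- (s *\<^sub>R b)"] by (simp add: power_mult_distrib)
    moreover have "s\<^sup>2 * (norm b)\<^sup>2 \<le> 2 * (s * inner y b)"
    proof -
      have "s\<^sup>2 * (norm b)\<^sup>2 \<le> s * (2 * \<mu>) * (norm b)\<^sup>2"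
        using lp step unfolding power2_eq_square by (intro mult_right_mono mult_left_mono) (auto simp: s_def)
      also have "\<dots> = 2 * (s * (\<mu> * (norm b)\<^sup>2))" by simp
      also have "\<dots> \<le> 2 * (s * inner y b)"
        using lp B_inner[OF z(1), of "x t"] by (intro mult_left_mono) (auto simp: y_def b_def)
      finally show ?thesis .
    qed
    ultimately show ?thesis by simp
  qed
  have e4: "l * inner (v t) (p - w) \<le> ?V / 32 + 8 * l\<^sup>2 * (norm (p - w))\<^sup>2"
    using inner_le_young[of "1/32" "v t" "l *\<^sub>R (p - w)"] by (simp add: power_mult_distrib)
  \<comment> \<open>Strong monotonicity speaks about \<open>v t + y\<close>, the conclusion about
    \<open>y\<close>; expanding the square costs one more cross term.\<close>
  have e5: "- (l * \<gamma> * (norm (v t + y))\<^sup>2) \<le> ?V / 32 + 32 * l\<^sup>2 * \<gamma>\<^sup>2 * (norm y)\<^sup>2 - l * \<gamma> * (norm y)\<^sup>2"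
  proof -
    have "0 \<le> l * \<gamma> * ?V" using lp \<gamma>_nonneg by simp
    moreover have "- (2 * l * \<gamma> * inner (v t) y) \<le> ?V / 32 + 32 * l\<^sup>2 * \<gamma>\<^sup>2 * (norm y)\<^sup>2"
      using inner_le_young[of "1/32" "v t" "- (2 * l * \<gamma>) *\<^sub>R y"] \<gamma>_nonneg
      by (simp add: power_mult_distrib)
    moreover have "l * \<gamma> * (norm (v t + y))\<^sup>2 = l * \<gamma> * ?V + 2 * l * \<gamma> * inner (v t) y + l * \<gamma> * (norm y)\<^sup>2"
      by (simp add: power2_norm_eq_inner algebra_simps inner_commute)
    ultimately show ?thesis by linarith
  qed
  have e6: "- (s * inner y b) / 6 + l * inner y p \<le> gap z p t"
    by (simp add: gap_def l_def s_def y_def b_def inner_diff_left algebra_simps diff_divide_distrib)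
  have "l * inner y d \<le> 0" using e2 lp by (simp add: mult_nonneg_nonpos)
  have lin: "2 * xv \<le> (16 * h + 64 * h') + (2 * g + 16 * c) - V / 4 - sb / 3 - 2 * gh - 2 * yw"
    if "V + xv + gv \<le> vd + yd - vb - sb + vp + yp - yw"
      "vd \<le> V / 32 + 8 * h" "yd \<le> 0" "- vb \<le> 3/4 * V + 2/3 * sb" "vp \<le> V / 32 + 8 * c"
      "- gv \<le> V / 32 + 32 * h' - gh" "- sb / 6 + yp \<le> g" "0 \<le> V"
    for xv h h' g c V sb gh yw vd yd vb vp yp gv :: real
    using that by argo
  have "2 * inner (v t) y \<le> (16 * (l\<^sup>2 * (norm y)\<^sup>2 / \<eta>\<^sup>2) + 64 * (l\<^sup>2 * \<gamma>\<^sup>2 * (norm y)\<^sup>2))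
      + (2 * gap z p t + 16 * (l\<^sup>2 * (norm (p - w))\<^sup>2)) - ?V / 4 - s * inner y b / 3
      - 2 * (l * \<gamma> * (norm y)\<^sup>2) - 2 * (l * inner y w)"
    by (rule lin[OF main _ \<open>l * inner y d \<le> 0\<close> e3 _ _ e6]) (use e1 e4 e5 in \<open>simp_all add: mult.assoc\<close>)
  then show ?thesis
    by (simp add: growth_def l_def s_def y_def b_def inner_commute algebra_simps)
qed

section \<open>Integrated energy estimates\<close>

lemma gap_cont: "continuous_on {0..} (gap z p)"
  unfolding gap_def by (intro cont) auto

lemma gap_nonneg: "0 \<le> gap z p t"
  by (simp add: gap_def)

lemma energy_decrease:
  fixes z w :: 'a
  defines "h \<equiv> \<lambda>t. (norm (x t - z))\<^sup>2"
  assumes s: "0 \<le> s" "s \<le> t" and step: "\<And>\<tau>. s \<le> \<tau> \<Longrightarrow> lam \<tau> * bet \<tau> \<le> 2 * \<mu>"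
    and z: "B z = 0" "a \<in> A z" "w = a + D z + p"
  shows "h t - h s \<le>
    integral {s..t} (\<lambda>\<tau>. growth * (lam \<tau>)\<^sup>2 * h \<tau> + (2 * gap z p \<tau> + 16 * (norm (p - w))\<^sup>2 * (lam \<tau>)\<^sup>2))
    - integral {s..t} (\<lambda>\<tau>. (norm (v \<tau>))\<^sup>2) / 4
    - integral {s..t} (\<lambda>\<tau>. lam \<tau> * bet \<tau> * inner (B (x \<tau>)) (x \<tau> - z)) / 3
    - 2 * \<gamma> * integral {s..t} (\<lambda>\<tau>. lam \<tau> * h \<tau>)
    - 2 * integral {s..t} (\<lambda>\<tau>. lam \<tau> * inner (x \<tau> - z) w)"
proof (rule has_integral_le_off_negligible[OF _ _ negl])
  show "((\<lambda>\<tau>. 2 * inner (x \<tau> - z) (v \<tau>)) has_integral (h t - h s)) {s..t}"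
    unfolding h_def by (rule energy_has_integral[OF s])
  have v_int: "(\<lambda>\<tau>. (norm (v \<tau>))\<^sup>2) integrable_on {s..t}"
    by (rule integrable_subinterval_real[OF norm_v_square_integrable[OF z(2), of t]]) (use s in auto)
  have h_cont: "continuous_on {0..} h" unfolding h_def by (intro cont)
  show "((\<lambda>\<tau>. growth * (lam \<tau>)\<^sup>2 * h \<tau> + (2 * gap z p \<tau> + 16 * (norm (p - w))\<^sup>2 * (lam \<tau>)\<^sup>2)
      - (norm (v \<tau>))\<^sup>2 / 4 - lam \<tau> * bet \<tau> * inner (B (x \<tau>)) (x \<tau> - z) / 3
      - 2 * \<gamma> * (lam \<tau> * h \<tau>) - 2 * (lam \<tau> * inner (x \<tau> - z) w)) has_integral
    (integral {s..t} (\<lambda>\<tau>. growth * (lam \<tau>)\<^sup>2 * h \<tau> + (2 * gap z p \<tau> + 16 * (norm (p - w))\<^sup>2 * (lam \<tau>)\<^sup>2))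
    - integral {s..t} (\<lambda>\<tau>. (norm (v \<tau>))\<^sup>2) / 4
    - integral {s..t} (\<lambda>\<tau>. lam \<tau> * bet \<tau> * inner (B (x \<tau>)) (x \<tau> - z)) / 3
    - 2 * \<gamma> * integral {s..t} (\<lambda>\<tau>. lam \<tau> * h \<tau>)
    - 2 * integral {s..t} (\<lambda>\<tau>. lam \<tau> * inner (x \<tau> - z) w))) {s..t}"
    by (intro has_integral_diff has_integral_mult_right has_integral_divide
        integrable_integral v_int integrable_interval[OF _ s(1)])
      (intro cont h_cont gap_cont)+
next
  fix \<tau> assume "\<tau> \<in> {s..t} - N"
  then have "\<tau> \<in> {0..} - N" "s \<le> \<tau>" using s by auto
  from energy_inequality[OF this(1) step[OF this(2)] z]
  show "2 * inner (x \<tau> - z) (v \<tau>) \<le>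
      growth * (lam \<tau>)\<^sup>2 * h \<tau> + (2 * gap z p \<tau> + 16 * (norm (p - w))\<^sup>2 * (lam \<tau>)\<^sup>2)
      - (norm (v \<tau>))\<^sup>2 / 4 - lam \<tau> * bet \<tau> * inner (B (x \<tau>)) (x \<tau> - z) / 3
      - 2 * \<gamma> * (lam \<tau> * h \<tau>) - 2 * (lam \<tau> * inner (x \<tau> - z) w)"
    by (simp add: h_def mult.assoc)
qed

lemma step_boundE:
  obtains t0 where "0 \<le> t0" "\<And>t. t0 \<le> t \<Longrightarrow> lam t * bet t \<le> 2 * \<mu>"
proof -
  obtain T where "\<And>t. T \<le> t \<Longrightarrow> lam t * bet t \<le> 2 * \<mu>"
    using step_bound unfolding eventually_at_top_linorder by blast
  then show thesis by (intro that[of "max 0 T"]) auto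
qed

lemma lam_sq_integrable: "0 \<le> a \<Longrightarrow> (\<lambda>t. c * (lam t)\<^sup>2) integrable_on {a..}"
proof -
  assume "0 \<le> a"
  have "(\<lambda>t. (lam t)\<^sup>2) integrable_on {a..}"
  proof (rule integrable_on_halfline_nonneg)
    fix T assume "a \<le> T"
    show "(\<lambda>t. (lam t)\<^sup>2) integrable_on {a..T}"
      by (rule integrable_interval[OF _ \<open>0 \<le> a\<close>]) (intro cont)
    show "integral {a..T} (\<lambda>t. (lam t)\<^sup>2) \<le> integral {0..} (\<lambda>t. (lam t)\<^sup>2)"
      using \<open>0 \<le> a\<close> by (intro integral_subinterval_le_halfline lam_sq) auto
  qed simp
  then show ?thesis by (rule integrable_on_mult_right)
qed

lemma gap_integrable_tail:
  assumes "gap z p integrable_on {0..}" "0 \<le> a"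
  shows "gap z p integrable_on {a..}"
proof (rule integrable_on_halfline_nonneg)
  fix T assume "a \<le> T"
  show "gap z p integrable_on {a..T}" by (rule integrable_interval[OF gap_cont assms(2)])
  show "integral {a..T} (gap z p) \<le> integral {0..} (gap z p)"
    using assms by (intro integral_subinterval_le_halfline gap_nonneg) auto
qed (rule gap_nonneg)

lemma growth_nonneg: "0 \<le> growth"
  by (simp add: growth_def)

lemma B_inner_nonneg: "B z = 0 \<Longrightarrow> 0 \<le> inner (B (x t)) (x t - z)"
  using B_inner[of z "x t"] order_trans[OF mult_nonneg_nonneg[of \<mu> "(norm (B (x t)))\<^sup>2"]] \<mu>_pos
  by (simp add: inner_commute)

text \<open>With \<open>w = 0\<close> the linear term disappears and every dissipative term may be
  dropped, so the Gronwall form applies after \<open>t0\<close>; before \<open>t0\<close>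
  compactness gives the bound.\<close>

lemma trajectory_bounded:
  assumes z: "B z = 0" "a \<in> A z" "a + D z + p = 0" and gap: "gap z p integrable_on {0..}"
  obtains M where "\<And>t. 0 \<le> t \<Longrightarrow> norm (x t - z) \<le> M"
proof -
  let ?h = "\<lambda>t. (norm (x t - z))\<^sup>2"
  obtain t0 where t0: "0 \<le> t0" "\<And>t. t0 \<le> t \<Longrightarrow> lam t * bet t \<le> 2 * \<mu>"
    using step_boundE by blast
  have h_cont: "continuous_on {0..} ?h" by (intro cont)
  obtain M where M: "\<And>t. t0 \<le> t \<Longrightarrow> ?h t \<le> M"
  proof (rule bounded_of_integrable_growth[of t0 ?h "\<lambda>t. growth * (lam t)\<^sup>2"
        "\<lambda>t. 2 * gap z p t + 16 * (norm p)\<^sup>2 * (lam t)\<^sup>2"])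
    have sub: "{t0..} \<subseteq> {0..}" using t0(1) by auto
    show "continuous_on {t0..} ?h" by (rule continuous_on_subset[OF h_cont sub])
    show "continuous_on {t0..} (\<lambda>t. growth * (lam t)\<^sup>2)"
      by (intro continuous_intros continuous_on_subset[OF lam_cont sub])
    show "(\<lambda>t. growth * (lam t)\<^sup>2) integrable_on {t0..}"
      by (rule lam_sq_integrable[OF t0(1)])
    show "(\<lambda>t. 2 * gap z p t + 16 * (norm p)\<^sup>2 * (lam t)\<^sup>2) integrable_on {t0..}"
      by (rule integrable_add[OF integrable_on_mult_right[OF gap_integrable_tail[OF gap t0(1)]]
            lam_sq_integrable[OF t0(1)]])
    show "0 \<le> growth * (lam t)\<^sup>2" "0 \<le> 2 * gap z p t + 16 * (norm p)\<^sup>2 * (lam t)\<^sup>2" for t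
      using growth_nonneg gap_nonneg[of z p t] by auto
    show "?h t - ?h s \<le> integral {s..t} (\<lambda>\<tau>. growth * (lam \<tau>)\<^sup>2 * ?h \<tau>
        + (2 * gap z p \<tau> + 16 * (norm p)\<^sup>2 * (lam \<tau>)\<^sup>2))" if "t0 \<le> s" "s \<le> t" for s t
    proof -
      have s: "0 \<le> s" using t0 that by simp
      have "0 \<le> integral {s..t} (\<lambda>\<tau>. (norm (v \<tau>))\<^sup>2)"
        using integrable_subinterval_real[OF norm_v_square_integrable[OF z(2), of t], of s t] s that
        by (intro integral_nonneg) auto
      moreover have "0 \<le> integral {s..t} (\<lambda>\<tau>. lam \<tau> * bet \<tau> * inner (B (x \<tau>)) (x \<tau> - z))"
      proof (rule integral_nonneg)
        show "(\<lambda>\<tau>. lam \<tau> * bet \<tau> * inner (B (x \<tau>)) (x \<tau> - z)) integrable_on {s..t}"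
          by (rule integrable_interval[OF _ s]) (intro cont)
      next
        fix \<tau> assume "\<tau> \<in> {s..t}"
        then show "0 \<le> lam \<tau> * bet \<tau> * inner (B (x \<tau>)) (x \<tau> - z)"
          using B_inner_nonneg[OF z(1)] lam_pos[of \<tau>] bet_pos[of \<tau>] s by simp
      qed
      moreover have "0 \<le> \<gamma> * integral {s..t} (\<lambda>\<tau>. lam \<tau> * ?h \<tau>)"
      proof (rule mult_nonneg_nonneg[OF \<gamma>_nonneg integral_nonneg])
        show "(\<lambda>\<tau>. lam \<tau> * ?h \<tau>) integrable_on {s..t}"
          by (rule integrable_interval[OF _ s]) (intro cont)
      next
        fix \<tau> assume "\<tau> \<in> {s..t}"
        then show "0 \<le> lam \<tau> * ?h \<tau>" using lam_pos[of \<tau>] s by simp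
      qed
      ultimately show ?thesis
        using energy_decrease[OF s that(2) t0(2) z(1,2) z(3)[symmetric]] that(1) by simp
    qed
    show "0 \<le> ?h t" for t by simp
  qed (rule that)
  have "bounded ((\<lambda>t. x t - z) ` {0..t0})"
    by (intro compact_imp_bounded compact_continuous_image continuous_on_diff continuous_on_const
        continuous_on_subset[OF x_cont]) auto
  then obtain R where "\<forall>y\<in>(\<lambda>t. x t - z) ` {0..t0}. norm y \<le> R"
    unfolding bounded_iff by blast
  then have R: "\<And>t. t \<in> {0..t0} \<Longrightarrow> norm (x t - z) \<le> R"
    by blast
  have "norm (x t - z) \<le> max R (sqrt M)" if "0 \<le> t" for t
    using R[of t] M[of t] that by (cases "t \<le> t0") (auto simp: real_le_rsqrt le_max_iff_disj)
  then show thesis by (rule that)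
qed

text \<open>A bound \<open>M\<close> on the distance turns the growth term into a multiple of
  \<open>lam\<close> squared, which joins the integrable \<open>k\<close>. The bound is a hypothesis
  because for nonzero \<open>w\<close> it is imported from a zero.\<close>

lemma dissipation_bounded:
  assumes z: "B z = 0" "a \<in> A z" "w = a + D z + p" and gap: "gap z p integrable_on {0..}"
    and M: "\<And>t. 0 \<le> t \<Longrightarrow> norm (x t - z) \<le> M"
  obtains t0 k where "0 \<le> t0" "k integrable_on {t0..}" "\<And>t. t0 \<le> t \<Longrightarrow> 0 \<le> k t"
    "\<And>s t. t0 \<le> s \<Longrightarrow> s \<le> t \<Longrightarrow> (norm (x t - z))\<^sup>2 - (norm (x s - z))\<^sup>2 \<le> integral {s..t} k
      - integral {s..t} (\<lambda>\<tau>. (norm (v \<tau>))\<^sup>2) / 4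
      - integral {s..t} (\<lambda>\<tau>. lam \<tau> * bet \<tau> * inner (B (x \<tau>)) (x \<tau> - z)) / 3
      - 2 * \<gamma> * integral {s..t} (\<lambda>\<tau>. lam \<tau> * (norm (x \<tau> - z))\<^sup>2)
      - 2 * integral {s..t} (\<lambda>\<tau>. lam \<tau> * inner (x \<tau> - z) w)"
proof -
  obtain t0 where t0: "0 \<le> t0" "\<And>t. t0 \<le> t \<Longrightarrow> lam t * bet t \<le> 2 * \<mu>"
    using step_boundE by blast
  let ?k = "\<lambda>t. growth * M\<^sup>2 * (lam t)\<^sup>2 + (2 * gap z p t + 16 * (norm (p - w))\<^sup>2 * (lam t)\<^sup>2)"
  let ?m = "\<lambda>t. growth * (lam t)\<^sup>2 * (norm (x t - z))\<^sup>2 + (2 * gap z p t + 16 * (norm (p - w))\<^sup>2 * (lam t)\<^sup>2)"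
  have le: "integral {s..t} ?m \<le> integral {s..t} ?k" if "t0 \<le> s" for s t
  proof (rule integral_le)
    have s: "0 \<le> s" using that t0 by simp
    show "?m integrable_on {s..t}" "?k integrable_on {s..t}"
      by (rule integrable_interval[OF _ s], intro cont gap_cont)+
    show "?m \<tau> \<le> ?k \<tau>" if "\<tau> \<in> {s..t}" for \<tau>
    proof -
      have "(norm (x \<tau> - z))\<^sup>2 \<le> M\<^sup>2" using M[of \<tau>] that s by (intro power_mono) auto
      then have "growth * (lam \<tau>)\<^sup>2 * (norm (x \<tau> - z))\<^sup>2 \<le> growth * (lam \<tau>)\<^sup>2 * M\<^sup>2"
        using growth_nonneg by (intro mult_left_mono) auto
      then show ?thesis by (simp add: mult_ac)
    qed
  qed
  show thesis
  proof (rule that[of t0 ?k])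
    show "?k integrable_on {t0..}"
      by (rule integrable_add[OF lam_sq_integrable[OF t0(1)] integrable_add[OF
            integrable_on_mult_right[OF gap_integrable_tail[OF gap t0(1)]] lam_sq_integrable[OF t0(1)]]])
    show "0 \<le> ?k t" for t
      using growth_nonneg gap_nonneg[of z p t] by auto
    fix s t assume st: "t0 \<le> s" "s \<le> t"
    then have "0 \<le> s" "\<And>\<tau>. s \<le> \<tau> \<Longrightarrow> lam \<tau> * bet \<tau> \<le> 2 * \<mu>" using t0 by auto
    from energy_decrease[OF this(1) st(2) this(2) z] le[OF st(1), of t]
    show "(norm (x t - z))\<^sup>2 - (norm (x s - z))\<^sup>2 \<le> integral {s..t} ?k
      - integral {s..t} (\<lambda>\<tau>. (norm (v \<tau>))\<^sup>2) / 4
      - integral {s..t} (\<lambda>\<tau>. lam \<tau> * bet \<tau> * inner (B (x \<tau>)) (x \<tau> - z)) / 3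
      - 2 * \<gamma> * integral {s..t} (\<lambda>\<tau>. lam \<tau> * (norm (x \<tau> - z))\<^sup>2)
      - 2 * integral {s..t} (\<lambda>\<tau>. lam \<tau> * inner (x \<tau> - z) w)"
      by linarith
  qed (rule t0(1))
qed

text \<open>The integrals of the three dissipative terms from \<open>t0\<close> are nonnegative and
  their weighted sum is bounded by \<open>c\<close>, so each is bounded separately. Dropping them
  all leaves an integrable increase of the squared distance and hence its limit.\<close>

lemma energy_estimates:
  assumes z: "B z = 0" "a \<in> A z" "a + D z + p = 0" and gap: "gap z p integrable_on {0..}"
  shows "\<exists>l. ((\<lambda>t. norm (x t - z)) \<longlongrightarrow> l) at_top"
    and "(\<lambda>t. (norm (v t))\<^sup>2) integrable_on {0..}"
    and "(\<lambda>t. lam t * bet t * inner (B (x t)) (x t - z)) integrable_on {0..}"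
    and "(\<lambda>t. lam t * bet t * (norm (B (x t)))\<^sup>2) integrable_on {0..}"
    and "0 < \<gamma> \<Longrightarrow> (\<lambda>t. lam t * (norm (x t - z))\<^sup>2) integrable_on {0..}"
proof -
  let ?h = "\<lambda>t. (norm (x t - z))\<^sup>2"
  let ?v = "\<lambda>t. (norm (v t))\<^sup>2"
  let ?b = "\<lambda>t. lam t * bet t * inner (B (x t)) (x t - z)"
  let ?g = "\<lambda>t. lam t * ?h t"
  obtain M where M: "\<And>t. 0 \<le> t \<Longrightarrow> norm (x t - z) \<le> M"
    using trajectory_bounded[OF z gap] by blast
  obtain t0 k where t0: "0 \<le> t0" and k: "k integrable_on {t0..}" "\<And>t. t0 \<le> t \<Longrightarrow> 0 \<le> k t"
    and dec: "\<And>s t. t0 \<le> s \<Longrightarrow> s \<le> t \<Longrightarrow> ?h t - ?h s \<le> integral {s..t} k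
      - integral {s..t} ?v / 4 - integral {s..t} ?b / 3 - 2 * \<gamma> * integral {s..t} ?g
      - 2 * integral {s..t} (\<lambda>\<tau>. lam \<tau> * inner (x \<tau> - z) 0)"
    using dissipation_bounded[OF z(1,2) z(3)[symmetric] gap M] by blast
  have v_int: "?v integrable_on {s..t}" if "0 \<le> s" for s t
    by (rule integrable_subinterval_real[OF norm_v_square_integrable[OF z(2), of "max 0 t"]])
       (use that in auto)
  have b_int: "?b integrable_on {s..t}" if "0 \<le> s" for s t
    by (rule integrable_interval[OF _ that]) (intro cont)
  have g_int: "?g integrable_on {s..t}" if "0 \<le> s" for s t
    by (rule integrable_interval[OF _ that]) (intro cont)
  have b_pos: "0 \<le> ?b t" and g_pos: "0 \<le> ?g t" if "0 \<le> t" for t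
    using that lam_pos[of t] bet_pos[of t] B_inner_nonneg[OF z(1), of t] by auto
  have "0 \<le> integral {s..t} ?v" if "0 \<le> s" for s t
    by (rule integral_nonneg[OF v_int[OF that]]) simp
  moreover have "0 \<le> integral {s..t} ?b" if "0 \<le> s" for s t
    by (rule integral_nonneg[OF b_int[OF that]]) (use that in \<open>auto intro: b_pos\<close>)
  moreover have "0 \<le> \<gamma> * integral {s..t} ?g" if "0 \<le> s" for s t
    by (rule mult_nonneg_nonneg[OF \<gamma>_nonneg integral_nonneg[OF g_int[OF that]]])
       (use that in \<open>auto intro: g_pos\<close>)
  ultimately have pos: "0 \<le> integral {s..t} ?v" "0 \<le> integral {s..t} ?b" "0 \<le> \<gamma> * integral {s..t} ?g"
    if "0 \<le> s" for s t
    using that by blast+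
  have dec': "?h t - ?h s \<le> integral {s..t} k - integral {s..t} ?v / 4 - integral {s..t} ?b / 3
      - 2 * (\<gamma> * integral {s..t} ?g)" if "t0 \<le> s" "s \<le> t" for s t
    using dec[OF that] by simp
  have total: "integral {t0..t} ?v / 4 + integral {t0..t} ?b / 3 + 2 * (\<gamma> * integral {t0..t} ?g)
      \<le> ?h t0 + integral {t0..} k" if "t0 \<le> t" for t
  proof -
    have "integral {t0..t} k \<le> integral {t0..} k"
      using k by (intro integral_subinterval_le_halfline) auto
    moreover have "0 \<le> ?h t" by simp
    ultimately show ?thesis using dec'[OF order_refl that] by linarith
  qed
  define c where "c = ?h t0 + integral {t0..} k"
  have parts: "integral {t0..t} ?v \<le> 4 * c" "integral {t0..t} ?b \<le> 3 * c"
      "\<gamma> * integral {t0..t} ?g \<le> c" if "t0 \<le> t" for t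
    using total[OF that] pos[OF t0, of t] unfolding c_def by argo+
  show "?v integrable_on {0..}"
    using integrable_on_halfline_nonneg[of t0 ?v "4 * c"] parts(1) v_int t0
    by (intro integrable_on_halfline_extend[OF v_int _ t0]) auto
  show b: "?b integrable_on {0..}"
    using integrable_on_halfline_nonneg[of t0 ?b "3 * c"] parts(2) b_int b_pos t0
    by (intro integrable_on_halfline_extend[OF b_int _ t0]) auto
  show "?g integrable_on {0..}" if "0 < \<gamma>"
  proof (rule integrable_on_halfline_extend[OF g_int _ t0])
    show "?g integrable_on {t0..}"
    proof (rule integrable_on_halfline_nonneg)
      show "integral {t0..T} ?g \<le> c / \<gamma>" if "t0 \<le> T" for T
        using parts(3)[OF that] \<open>0 < \<gamma>\<close> by (simp add: pos_le_divide_eq mult.commute)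
    qed (use g_pos g_int t0 in auto)
  qed simp
  show "(\<lambda>t. lam t * bet t * (norm (B (x t)))\<^sup>2) integrable_on {0..}"
  proof (rule integrable_on_halfline_bounded_by)
    show "(\<lambda>t. lam t * bet t * (norm (B (x t)))\<^sup>2) integrable_on {0..T}" for T
      by (rule integrable_interval) (intro cont, simp)
    show "0 \<le> lam t * bet t * (norm (B (x t)))\<^sup>2" if "0 \<le> t" for t
      using lam_pos[OF that] bet_pos[OF that] by simp
    show "(\<lambda>t. (1 / \<mu>) * ?b t) integrable_on {0..}"
      using b by (rule integrable_on_mult_right)
    show "lam t * bet t * (norm (B (x t)))\<^sup>2 \<le> (1 / \<mu>) * ?b t" if "0 \<le> t" for t
    proof -
      have "\<mu> * (norm (B (x t)))\<^sup>2 \<le> inner (B (x t)) (x t - z)"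
        using B_inner[OF z(1), of "x t"] by (simp add: inner_commute)
      then have "lam t * bet t * (\<mu> * (norm (B (x t)))\<^sup>2) \<le> ?b t"
        using lam_pos[OF that] bet_pos[OF that] by (intro mult_left_mono) auto
      then show ?thesis using \<mu>_pos by (simp add: field_simps)
    qed
  qed
  obtain l where "(?h \<longlongrightarrow> l) at_top"
  proof (rule tendsto_of_integrable_increase[of t0 ?h k])
    show "?h t - ?h s \<le> integral {s..t} k" if "t0 \<le> s" "s \<le> t" for s t
      using dec'[OF that] pos[of s t] t0 that by linarith
  qed (use k that in auto)
  then have "((\<lambda>t. sqrt (?h t)) \<longlongrightarrow> sqrt l) at_top" by (rule tendsto_real_sqrt)
  then show "\<exists>l. ((\<lambda>t. norm (x t - z)) \<longlongrightarrow> l) at_top" by auto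
qed

section \<open>Weighted averages of the trajectory\<close>

lemma lam_integral_at_top: "filterlim (\<lambda>t. integral {0..t} lam) at_top at_top"
  by (rule filterlim_integral_halfline[OF _ _ lam_not])
     (auto intro: less_imp_le lam_pos integrable_interval lam_cont)

text \<open>A bound \<open>c\<close> independent of \<open>t\<close> is negligible against the
  diverging integral of \<open>lam\<close>.\<close>

lemma average_le_of_integral_bound:
  fixes f :: "real \<Rightarrow> real"
  assumes f: "continuous_on {0..} f"
    and c: "\<And>t. t0 \<le> t \<Longrightarrow> integral {0..t} (\<lambda>\<tau>. lam \<tau> * (f \<tau> - r)) \<le> c" and "0 < e"
  shows "eventually (\<lambda>t. integral {0..t} (\<lambda>\<tau>. lam \<tau> * f \<tau>) / integral {0..t} lam \<le> r + e) at_top"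
proof -
  \<comment> \<open>The 1 makes the denominator positive; \<open>c / e\<close> makes it large enough
    to absorb \<open>c\<close>.\<close>
  have "eventually (\<lambda>t. max 1 (c / e) \<le> integral {0..t} lam) at_top"
    using lam_integral_at_top unfolding filterlim_at_top by blast
  then show ?thesis
    using eventually_ge_at_top[of t0]
  proof eventually_elim
    fix t assume L: "max 1 (c / e) \<le> integral {0..t} lam" and t: "t0 \<le> t"
    have "(\<lambda>\<tau>. lam \<tau> * f \<tau>) integrable_on {0..t}"
      by (rule integrable_interval) (intro cont f, simp)
    moreover have "lam integrable_on {0..t}"
      by (rule integrable_interval[OF lam_cont]) simp
    ultimately have "integral {0..t} (\<lambda>\<tau>. lam \<tau> * (f \<tau> - r))
        = integral {0..t} (\<lambda>\<tau>. lam \<tau> * f \<tau>) - integral {0..t} lam * r"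
      by (simp add: right_diff_distrib Henstock_Kurzweil_Integration.integral_diff integrable_on_mult_left)
    moreover have "c \<le> e * integral {0..t} lam"
      using L \<open>0 < e\<close> by (simp add: pos_divide_le_eq mult.commute)
    ultimately have "integral {0..t} (\<lambda>\<tau>. lam \<tau> * f \<tau>) \<le> (r + e) * integral {0..t} lam"
      using c[OF t] by (simp add: algebra_simps)
    then show "integral {0..t} (\<lambda>\<tau>. lam \<tau> * f \<tau>) / integral {0..t} lam \<le> r + e"
      using L by (subst pos_divide_le_eq) auto
  qed
qed

text \<open>Cesaro's argument: half of \<open>e\<close> covers the tail, where \<open>f\<close> is
  below \<open>r + e / 2\<close>, and the other half the fixed head.\<close>

lemma average_eventually_le:
  fixes f :: "real \<Rightarrow> real"
  assumes f: "continuous_on {0..} f" and lim: "(f \<longlongrightarrow> r) at_top" and "0 < e"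
  shows "eventually (\<lambda>t. integral {0..t} (\<lambda>\<tau>. lam \<tau> * f \<tau>) / integral {0..t} lam \<le> r + e) at_top"
proof -
  have "eventually (\<lambda>t. f t < r + e / 2) at_top"
    using order_tendstoD(2)[OF lim, of "r + e / 2"] \<open>0 < e\<close> by simp
  then obtain T where T: "\<And>t. T \<le> t \<Longrightarrow> f t < r + e / 2"
    unfolding eventually_at_top_linorder by blast
  define t0 where "t0 = max 0 T"
  let ?F = "\<lambda>\<tau>. lam \<tau> * (f \<tau> - (r + e / 2))"
  have int: "?F integrable_on {s..t}" if "0 \<le> s" for s t
    by (rule integrable_interval[OF _ that]) (intro cont f; simp)
  have bound: "integral {0..t} ?F \<le> integral {0..t0} ?F" if "t0 \<le> t" for t
  proof -
    have "integral {0..t0} ?F + integral {t0..t} ?F = integral {0..t} ?F"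
      using that by (intro Henstock_Kurzweil_Integration.integral_combine int) (auto simp: t0_def)
    moreover have "integral {t0..t} ?F \<le> integral {t0..t} (\<lambda>_. 0)"
    proof (rule integral_le)
      fix \<tau> assume "\<tau> \<in> {t0..t}"
      then show "?F \<tau> \<le> 0"
        using lam_pos[of \<tau>] T[of \<tau>] by (intro mult_nonneg_nonpos) (auto simp: t0_def)
    qed (auto intro: int simp: t0_def)
    ultimately show ?thesis by simp
  qed
  from average_le_of_integral_bound[OF f bound, where ?t0.0 = t0 and e = "e / 2"] \<open>0 < e\<close>
  show ?thesis by (simp add: add.commute)
qed

lemma weighted_average_inner:
  "inner (weighted_average lam x t) y = integral {0..t} (\<lambda>\<tau>. lam \<tau> * inner (x \<tau>) y) / integral {0..t} lam"
proof -
  have "continuous_on {0..t} (\<lambda>\<tau>. lam \<tau> *\<^sub>R x \<tau>)"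
    by (rule continuous_on_subset[of "{0..}"]) (intro cont, auto)
  then have "(\<lambda>\<tau>. lam \<tau> *\<^sub>R x \<tau>) integrable_on {0..t}"
    by (rule integrable_continuous_Hilbert)
  from integral_linear[OF this bounded_linear_inner_left[of y]]
  show ?thesis by (simp add: weighted_average_def comp_def)
qed

lemma weighted_average_bounded:
  assumes M: "\<And>t. 0 \<le> t \<Longrightarrow> norm (x t - z) \<le> M"
  obtains T where "bounded (weighted_average lam x ` {T..})"
proof -
  have "eventually (\<lambda>t. 1 \<le> integral {0..t} lam) at_top"
    using lam_integral_at_top unfolding filterlim_at_top by blast
  then obtain T where T: "\<And>t. T \<le> t \<Longrightarrow> 1 \<le> integral {0..t} lam"
    unfolding eventually_at_top_linorder by blast
  have "norm (weighted_average lam x t) \<le> norm z + M" if "T \<le> t" for t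
  proof -
    \<comment> \<open>The average is paired with itself, which reduces the bound to a real
      integral.\<close>
    define y where "y = weighted_average lam x t"
    have "integral {0..t} (\<lambda>\<tau>. lam \<tau> * inner (x \<tau>) y) \<le> integral {0..t} (\<lambda>\<tau>. lam \<tau> * ((norm z + M) * norm y))"
    proof (rule integral_le)
      show "(\<lambda>\<tau>. lam \<tau> * inner (x \<tau>) y) integrable_on {0..t}"
        by (rule integrable_interval) (intro cont, simp)
      show "(\<lambda>\<tau>. lam \<tau> * ((norm z + M) * norm y)) integrable_on {0..t}"
        by (rule integrable_interval) (intro cont, simp)
    next
      fix \<tau> assume \<tau>: "\<tau> \<in> {0..t}"
      have "norm (x \<tau>) \<le> norm z + M"
        using M[of \<tau>] \<tau> norm_triangle_sub[of "x \<tau>" z] by auto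
      then have "inner (x \<tau>) y \<le> (norm z + M) * norm y"
        by (meson mult_right_mono norm_cauchy_schwarz norm_ge_zero order_trans)
      then show "lam \<tau> * inner (x \<tau>) y \<le> lam \<tau> * ((norm z + M) * norm y)"
        using lam_pos[of \<tau>] \<tau> by simp
    qed
    also have "\<dots> = integral {0..t} lam * ((norm z + M) * norm y)" by simp
    finally have "inner y y \<le> (norm z + M) * norm y"
      using T[OF that] unfolding y_def weighted_average_inner by (subst pos_divide_le_eq) (auto simp: mult.commute)
    then have "norm y * norm y \<le> (norm z + M) * norm y"
      by (simp add: power2_norm_eq_inner flip: power2_eq_square)
    moreover have "0 \<le> norm z + M" using M[of 0] norm_ge_zero[of "x 0 - z"] norm_ge_zero[of z] by linarith
    ultimately show ?thesis
      unfolding y_def[symmetric] by (cases "norm y = 0") (auto simp: mult_le_cancel_right)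
  qed
  then have "bounded (weighted_average lam x ` {T..})"
    unfolding bounded_iff by auto
  then show thesis by (rule that)
qed

lemma average_variational_inequality:
  assumes z: "B z = 0" "a \<in> A z" "w = a + D z + p" and gap: "gap z p integrable_on {0..}"
    and M: "\<And>t. 0 \<le> t \<Longrightarrow> norm (x t - z) \<le> M" and "0 < e"
  shows "eventually (\<lambda>t. inner (weighted_average lam x t - z) w \<le> e) at_top"
proof -
  obtain t0 k where t0: "0 \<le> t0" and k: "k integrable_on {t0..}" "\<And>t. t0 \<le> t \<Longrightarrow> 0 \<le> k t"
    and dec: "\<And>s t. t0 \<le> s \<Longrightarrow> s \<le> t \<Longrightarrow> (norm (x t - z))\<^sup>2 - (norm (x s - z))\<^sup>2 \<le> integral {s..t} k
      - integral {s..t} (\<lambda>\<tau>. (norm (v \<tau>))\<^sup>2) / 4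
      - integral {s..t} (\<lambda>\<tau>. lam \<tau> * bet \<tau> * inner (B (x \<tau>)) (x \<tau> - z)) / 3
      - 2 * \<gamma> * integral {s..t} (\<lambda>\<tau>. lam \<tau> * (norm (x \<tau> - z))\<^sup>2)
      - 2 * integral {s..t} (\<lambda>\<tau>. lam \<tau> * inner (x \<tau> - z) w)"
    using dissipation_bounded[OF z gap M] by blast
  let ?F = "\<lambda>\<tau>. lam \<tau> * inner (x \<tau> - z) w"
  have int: "?F integrable_on {s..t}" if "0 \<le> s" for s t
    by (rule integrable_interval[OF _ that]) (intro cont)
  have bound: "integral {0..t} ?F \<le> integral {0..t0} ?F + (norm (x t0 - z))\<^sup>2 + integral {t0..} k"
    if "t0 \<le> t" for t
  proof -
    have "0 \<le> integral {t0..t} (\<lambda>\<tau>. (norm (v \<tau>))\<^sup>2)"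
      using integrable_subinterval_real[OF norm_v_square_integrable[OF z(2), of t], of t0 t] t0 that
      by (intro integral_nonneg) auto
    moreover have "0 \<le> integral {t0..t} (\<lambda>\<tau>. lam \<tau> * bet \<tau> * inner (B (x \<tau>)) (x \<tau> - z))"
    proof (rule integral_nonneg)
      show "(\<lambda>\<tau>. lam \<tau> * bet \<tau> * inner (B (x \<tau>)) (x \<tau> - z)) integrable_on {t0..t}"
        by (rule integrable_interval[OF _ t0]) (intro cont)
    next
      fix \<tau> assume "\<tau> \<in> {t0..t}"
      then show "0 \<le> lam \<tau> * bet \<tau> * inner (B (x \<tau>)) (x \<tau> - z)"
        using B_inner_nonneg[OF z(1)] lam_pos[of \<tau>] bet_pos[of \<tau>] t0 by simp
    qed
    moreover have "0 \<le> \<gamma> * integral {t0..t} (\<lambda>\<tau>. lam \<tau> * (norm (x \<tau> - z))\<^sup>2)"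
    proof (rule mult_nonneg_nonneg[OF \<gamma>_nonneg integral_nonneg])
      show "(\<lambda>\<tau>. lam \<tau> * (norm (x \<tau> - z))\<^sup>2) integrable_on {t0..t}"
        by (rule integrable_interval[OF _ t0]) (intro cont)
    next
      fix \<tau> assume "\<tau> \<in> {t0..t}"
      then show "0 \<le> lam \<tau> * (norm (x \<tau> - z))\<^sup>2" using lam_pos[of \<tau>] t0 by simp
    qed
    moreover have "integral {t0..t} k \<le> integral {t0..} k"
      using k by (intro integral_subinterval_le_halfline) auto
    moreover have "integral {0..t0} ?F + integral {t0..t} ?F = integral {0..t} ?F"
      using that t0 by (intro Henstock_Kurzweil_Integration.integral_combine int) auto
    \<comment> \<open>As the constant is nonnegative, the factor 2 in front of the linear term can
      be given away.\<close>
    moreover have "0 \<le> integral {t0..} k"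
      using k by (intro integral_nonneg) auto
    moreover have "0 \<le> (norm (x t - z))\<^sup>2" "0 \<le> (norm (x t0 - z))\<^sup>2" by simp_all
    ultimately show ?thesis using dec[OF order_refl that] unfolding mult.assoc by argo
  qed
  have "eventually (\<lambda>t. integral {0..t} (\<lambda>\<tau>. lam \<tau> * inner (x \<tau>) w) / integral {0..t} lam \<le> inner z w + e) at_top"
    by (rule average_le_of_integral_bound[OF _ _ \<open>0 < e\<close>, where ?t0.0 = t0])
       (intro cont, use bound in \<open>simp add: inner_diff_left\<close>)
  then show ?thesis
    by (simp add: inner_diff_left weighted_average_inner algebra_simps)
qed

text \<open>Opial's argument: the difference of the squared distances to \<open>z1\<close> and
  \<open>z2\<close> is affine in \<open>x t\<close>, so \<open>inner (x t) d\<close> converges. Its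
  averages have the same limit \<open>r\<close>, hence both candidates have inner product
  \<open>r\<close> with their difference \<open>d\<close>, which must be 0.\<close>

lemma average_hull_unique:
  assumes l: "((\<lambda>t. norm (x t - z1)) \<longlongrightarrow> l1) at_top" "((\<lambda>t. norm (x t - z2)) \<longlongrightarrow> l2) at_top"
    and z1: "\<And>T. z1 \<in> closure (convex hull (weighted_average lam x ` {T..}))"
    and z2: "\<And>T. z2 \<in> closure (convex hull (weighted_average lam x ` {T..}))"
  shows "z1 = z2"
proof -
  define d where "d = z1 - z2"
  define r where "r = (l2\<^sup>2 - l1\<^sup>2 + inner z1 z1 - inner z2 z2) / 2"
  have "inner (x t) d = ((norm (x t - z2))\<^sup>2 - (norm (x t - z1))\<^sup>2 + inner z1 z1 - inner z2 z2) / 2" for t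
    by (simp add: d_def power2_norm_eq_inner algebra_simps inner_commute)
  moreover have "((\<lambda>t. ((norm (x t - z2))\<^sup>2 - (norm (x t - z1))\<^sup>2 + inner z1 z1 - inner z2 z2) / 2) \<longlongrightarrow> r) at_top"
    unfolding r_def by (intro tendsto_intros l) simp
  ultimately have lim: "((\<lambda>t. inner (x t) d) \<longlongrightarrow> r) at_top" by (simp only:)
  have upper: "inner u y \<le> r' + e"
    if u: "\<And>T. u \<in> closure (convex hull (weighted_average lam x ` {T..}))"
      and y: "((\<lambda>t. inner (x t) y) \<longlongrightarrow> r') at_top" and "0 < e" for u y r' e
    by (rule closure_hull_inner_le[OF _ u])
       (unfold weighted_average_inner, rule average_eventually_le[OF _ y \<open>0 < e\<close>], intro cont)
  have eq: "inner u d = r"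
    if u: "\<And>T. u \<in> closure (convex hull (weighted_average lam x ` {T..}))" for u
  proof (rule antisym)
    show "inner u d \<le> r"
      by (rule field_le_epsilon) (rule upper[OF u lim])
    have neg: "((\<lambda>t. inner (x t) (- d)) \<longlongrightarrow> - r) at_top"
      using tendsto_minus[OF lim] by simp
    have "inner u (- d) \<le> - r"
      by (rule field_le_epsilon) (rule upper[OF u neg])
    then show "r \<le> inner u d" by simp
  qed
  have "inner d d = inner z1 d - inner z2 d" by (simp add: d_def inner_diff_left)
  then have "inner d d = 0" using eq[OF z1] eq[OF z2] by simp
  then show ?thesis by (simp add: d_def)
qed

text \<open>A positive limit \<open>l\<close> of the distance would keep it above
  \<open>l / 2\<close> eventually, and \<open>lam\<close> would be dominated by a multiple of an
  integrable function.\<close>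

lemma strong_limit:
  assumes z: "B z = 0" "a \<in> A z" "a + D z + p = 0" and gap: "gap z p integrable_on {0..}"
    and "0 < \<gamma>"
  shows "(x \<longlongrightarrow> z) at_top"
proof -
  obtain l where l: "((\<lambda>t. norm (x t - z)) \<longlongrightarrow> l) at_top"
    using energy_estimates(1)[OF z gap] by blast
  have "0 \<le> l" using l by (rule tendsto_lowerbound) auto
  have "l = 0"
  proof (rule ccontr)
    assume "l \<noteq> 0"
    then have "0 < l / 2" "l / 2 < l" using \<open>0 \<le> l\<close> by auto
    then obtain T where T: "\<And>t. T \<le> t \<Longrightarrow> l / 2 < norm (x t - z)"
      using order_tendstoD(1)[OF l, of "l / 2"] unfolding eventually_at_top_linorder by blast
    define t0 where "t0 = max 0 T"
    have "0 \<le> t0" by (simp add: t0_def)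
    let ?g = "\<lambda>t. lam t * (norm (x t - z))\<^sup>2"
    have g_pos: "0 \<le> ?g t" if "0 \<le> t" for t
      using lam_pos[OF that] by simp
    have g: "?g integrable_on {t0..}"
    proof (rule integrable_on_halfline_nonneg)
      show "?g integrable_on {t0..t}" for t
        by (rule integrable_interval[OF _ \<open>0 \<le> t0\<close>]) (intro cont)
      show "integral {t0..t} ?g \<le> integral {0..} ?g" for t
        by (rule integral_subinterval_le_halfline[OF energy_estimates(5)[OF z gap \<open>0 < \<gamma>\<close>] g_pos \<open>0 \<le> t0\<close>])
      show "0 \<le> ?g t" if "t0 \<le> t" for t
        using g_pos[of t] that \<open>0 \<le> t0\<close> by simp
    qed
    have "lam integrable_on {t0..}"
    proof (rule integrable_on_halfline_bounded_by)
      show "lam integrable_on {t0..t}" for t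
        by (rule integrable_interval[OF lam_cont \<open>0 \<le> t0\<close>])
      show "0 \<le> lam t" if "t0 \<le> t" for t
        using lam_pos[of t] that \<open>0 \<le> t0\<close> by simp
      show "(\<lambda>t. (1 / (l / 2)\<^sup>2) * ?g t) integrable_on {t0..}"
        using g by (rule integrable_on_mult_right)
      show "lam t \<le> (1 / (l / 2)\<^sup>2) * ?g t" if "t0 \<le> t" for t
      proof -
        have "(l / 2)\<^sup>2 \<le> (norm (x t - z))\<^sup>2"
          using T[of t] that \<open>0 < l / 2\<close> by (intro power_mono) (auto simp: t0_def)
        then have "lam t * (l / 2)\<^sup>2 \<le> ?g t"
          using lam_pos[of t] that \<open>0 \<le> t0\<close> by (intro mult_left_mono) auto
        moreover have "0 < (l / 2)\<^sup>2" using \<open>0 < l / 2\<close> by (rule zero_less_power)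
        ultimately have "lam t \<le> ?g t / (l / 2)\<^sup>2" by (simp only: pos_le_divide_eq)
        then show ?thesis by simp
      qed
    qed
    then have "lam integrable_on {0..}"
      using integrable_on_halfline_extend[OF integrable_interval[OF lam_cont order_refl] _ \<open>0 \<le> t0\<close>] by blast
    then show False using lam_not by simp
  qed
  with l show ?thesis by (simp add: tendsto_norm_zero_iff LIM_zero_iff)
qed

text \<open>At the point \<open>u\<close> of \<open>C\<close>, two graph points bound the
  Fitzpatrick supremum from below: \<open>(u, B u)\<close> yields 0 and
  \<open>(x t, B (x t))\<close> the bracket inside \<open>gap\<close>. The integrand in the
  hypothesis is therefore nonnegative and dominates \<open>gap\<close>.\<close>

lemma gap_integrable:
  assumes BC: "\<And>y. y \<in> C \<Longrightarrow> B y = 0" and p: "p \<in> normal_cone C u"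
    and fin: "halfline_integral (\<lambda>t. ereal (lam t * bet t) *
             ((SUP u\<in>C. fitzpatrick (op_of_fun B) u ((1 / bet t) *\<^sub>R (6 *\<^sub>R p)))
               - support_function C ((1 / bet t) *\<^sub>R (6 *\<^sub>R p)))) < \<infinity>"
  shows "gap u p integrable_on {0..}"
proof -
  let ?f = "\<lambda>t. ereal (lam t * bet t) *
             ((SUP u\<in>C. fitzpatrick (op_of_fun B) u ((1 / bet t) *\<^sub>R (6 *\<^sub>R p)))
               - support_function C ((1 / bet t) *\<^sub>R (6 *\<^sub>R p)))"
  have u: "u \<in> C" and pC: "\<And>y. y \<in> C \<Longrightarrow> inner (y - u) p \<le> 0"
    using p by (auto simp: normal_cone_def split: if_splits)
  have le: "ereal (gap u p t) \<le> ?f t" if t: "0 \<le> t" for t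
  proof -
    have pos: "0 < lam t" "0 < bet t" using lam_pos bet_pos t by auto
    define q where "q = (1 / bet t) *\<^sub>R (6 *\<^sub>R p)"
    \<comment> \<open>\<open>q\<close> is a positive multiple of the normal vector \<open>p\<close>
      at \<open>u\<close>, so the supremum is attained at \<open>u\<close>.\<close>
    have \<sigma>: "support_function C q = ereal (inner u q)"
      unfolding support_function_def
    proof (rule antisym)
      show "(SUP y\<in>C. ereal (inner y q)) \<le> ereal (inner u q)"
      proof (rule SUP_least)
        fix y assume "y \<in> C"
        then have "inner (y - u) q \<le> 0"
          using pC[of y] pos by (simp add: q_def divide_nonpos_pos)
        then show "ereal (inner y q) \<le> ereal (inner u q)" by (simp add: inner_diff_left)
      qed
    qed (use u in \<open>auto intro: SUP_upper\<close>)
    let ?\<phi> = "SUP u\<in>C. fitzpatrick (op_of_fun B) u q"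
    have \<phi>: "ereal (inner u (B y) + inner y q - inner y (B y)) \<le> ?\<phi>" for y
    proof -
      have "ereal (inner u (B y) + inner y q - inner y (B y)) \<le> fitzpatrick (op_of_fun B) u q"
        unfolding fitzpatrick_def op_graph_def op_of_fun_def
        by (rule SUP_upper2[of "(y, B y)"]) auto
      also have "\<dots> \<le> ?\<phi>" by (rule SUP_upper[OF u])
      finally show ?thesis .
    qed
    define m where "m = max 0 (inner (u - x t) (B (x t)) + inner (x t - u) q)"
    have "ereal m \<le> ?\<phi> - support_function C q"
    proof -
      have 1: "ereal (inner u (B y) + inner y q - inner y (B y) - inner u q) \<le> ?\<phi> - support_function C q" for y
        using ereal_minus_mono[OF \<phi>[of y] order_refl, of "ereal (inner u q)"] by (simp add: \<sigma>)
      from 1[of u] 1[of "x t"] show ?thesis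
        by (simp add: m_def BC[OF u] max_def algebra_simps zero_ereal_def)
    qed
    then have "ereal (lam t * bet t) * ereal m \<le> ?f t"
      using pos unfolding q_def by (intro ereal_mult_left_mono) auto
    moreover have "gap u p t \<le> lam t * bet t * m"
    proof -
      \<comment> \<open>The 6 in \<open>q\<close> meets the 1/6 in \<open>gap\<close>: multiplying
        \<open>q\<close> by \<open>lam t * bet t / 6\<close> gives \<open>lam t\<close> times
        \<open>p\<close>.\<close>
      have eq: "lam t * bet t * inner (u - x t) (B (x t)) / 6 + lam t * inner (x t - u) p
          = lam t * bet t * (inner (u - x t) (B (x t)) + inner (x t - u) q) / 6"
        using pos by (simp add: q_def field_simps)
      have "lam t * bet t * (inner (u - x t) (B (x t)) + inner (x t - u) q) \<le> lam t * bet t * m"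
        using pos by (intro mult_left_mono) (auto simp: m_def)
      moreover have "0 \<le> lam t * bet t * m" using pos by (simp add: m_def)
      ultimately show ?thesis unfolding gap_def eq by simp
    qed
    ultimately show ?thesis using order_trans by (simp flip: ereal_less_eq(3))
  qed
  have "set_integrable lebesgue {0..} (gap u p)"
    unfolding set_integrable_def
  proof (rule integrableI_bounded)
    have "gap u p \<in> borel_measurable (lebesgue_on {0..})"
      by (rule continuous_imp_measurable_on_sets_lebesgue[OF gap_cont]) simp
    then show "(\<lambda>t. indicator {0..} t *\<^sub>R gap u p t) \<in> borel_measurable lebesgue"
      by (simp add: borel_measurable_restrict_space_iff)
    have "(\<integral>\<^sup>+t. ennreal (norm (indicator {0..} t *\<^sub>R gap u p t)) \<partial>lebesgue)
        \<le> (\<integral>\<^sup>+t\<in>{0..}. e2ennreal (?f t) \<partial>lebesgue)"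
    proof (rule nn_integral_mono)
      fix t :: real
      show "ennreal (norm (indicator {0..} t *\<^sub>R gap u p t)) \<le> e2ennreal (?f t) * indicator {0..} t"
      proof (cases "0 \<le> t")
        case True
        have "ennreal (gap u p t) \<le> e2ennreal (?f t)"
          using e2ennreal_mono[OF le[OF True]] by simp
        then show ?thesis using True gap_nonneg[of u p t] by simp
      qed simp
    qed
    then show "(\<integral>\<^sup>+t. ennreal (norm (indicator {0..} t *\<^sub>R gap u p t)) \<partial>lebesgue) < \<infinity>"
      using fin unfolding halfline_integral_def by (rule le_less_trans)
  qed
  then show ?thesis by (rule set_lebesgue_integral_eq_integral(1))
qed

end

section \<open>From the strong solution to the convergence theorem\<close>

lemma strong_global_solution_null_set:
  fixes x :: "real \<Rightarrow> 'a::real_inner"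
  assumes "strong_global_solution A D B lam bet x0 x"
  obtains N where "negligible N"
    "\<And>t. t \<in> {0..} - N \<Longrightarrow> (x has_vector_derivative velocity x t) (at t within {0..})"
    "\<And>t. t \<in> {0..} - N \<Longrightarrow> \<exists>a\<in>A (velocity x t + x t).
       velocity x t = - (lam t *\<^sub>R (a + D (x t) + bet t *\<^sub>R B (x t)))"
proof -
  let ?P = "\<lambda>t. x differentiable (at t within {0..}) \<and>
        resolvent (op_scale (lam t) A)
          (x t - lam t *\<^sub>R D (x t) - (lam t * bet t) *\<^sub>R B (x t)) = {velocity x t + x t}"
  have "AE t in lebesgue. t \<ge> 0 \<longrightarrow> ?P t"
    using assms by (simp add: strong_global_solution_def)
  then obtain N where N: "N \<in> null_sets lebesgue" "\<And>t. t \<in> {0..} - N \<Longrightarrow> ?P t"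
    by (auto simp: completion.AE_iff_null_sets)
  show thesis
  proof (rule that[of N])
    show "negligible N" using N(1) by (simp add: negligible_iff_null_sets)
    fix t assume t: "t \<in> {0..} - N"
    show "(x has_vector_derivative velocity x t) (at t within {0..})"
      using N(2)[OF t] unfolding velocity_def by (simp add: vector_derivative_works)
    have "velocity x t + x t \<in> resolvent (op_scale (lam t) A)
          (x t - lam t *\<^sub>R D (x t) - (lam t * bet t) *\<^sub>R B (x t))"
      using N(2)[OF t] by simp
    then obtain a where a: "a \<in> A (velocity x t + x t)"
      "x t - lam t *\<^sub>R D (x t) - (lam t * bet t) *\<^sub>R B (x t) = velocity x t + x t + lam t *\<^sub>R a"
      by (auto simp: resolvent_def op_inverse_def op_add_def op_of_fun_def op_scale_def)
    have "velocity x t = (velocity x t + x t + lam t *\<^sub>R a) - x t - lam t *\<^sub>R a" by simp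
    also have "\<dots> = - (lam t *\<^sub>R (a + D (x t) + bet t *\<^sub>R B (x t)))"
      unfolding a(2)[symmetric] by (simp add: algebra_simps)
    finally show "\<exists>a\<in>A (velocity x t + x t).
       velocity x t = - (lam t *\<^sub>R (a + D (x t) + bet t *\<^sub>R B (x t)))"
      using a(1) by blast
  qed
qed

theorem theorem11:
  fixes A :: "'a::{real_inner, complete_space} operator"
    and D B :: "'a \<Rightarrow> 'a"
    and \<eta> \<mu> :: real
    and C :: "'a set"
    and lam bet :: "real \<Rightarrow> real"
    and x0 :: 'a
    and x :: "real \<Rightarrow> 'a"
  assumes "maximally_monotone A"
    and "\<eta> > 0" and "cocoercive \<eta> D"
    and "\<mu> > 0" and "cocoercive \<mu> B"
    and "C = op_zer (op_of_fun B)" and "C \<noteq> {}"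
    and "\<forall>t\<ge>0. lam t > 0" and "\<forall>b>0. continuous_on {0..b} lam"
    and "\<forall>t\<ge>0. bet t > 0" and "\<forall>b>0. continuous_on {0..b} bet"
    and "strong_global_solution A D B lam bet x0 x"
    and "Limsup at_top (\<lambda>t. ereal (lam t * bet t)) < ereal (2 * \<mu>)"
    and "maximally_monotone (op_add A (normal_cone C))"
    and "op_zer (op_add (op_add A (op_of_fun D)) (normal_cone C)) \<noteq> {}"
    and "set_integrable lebesgue {0..} (\<lambda>t. (lam t)\<^sup>2)"
    and "\<not> set_integrable lebesgue {0..} lam"
    and "\<forall>p \<in> op_ran (normal_cone C).
           halfline_integral (\<lambda>t. ereal (lam t * bet t) *
             ((SUP u\<in>C. fitzpatrick (op_of_fun B) u ((1 / bet t) *\<^sub>R p))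
               - support_function C ((1 / bet t) *\<^sub>R p))) < \<infinity>"
  shows "(\<forall>z \<in> op_zer (op_add (op_add A (op_of_fun D)) (normal_cone C)).
            (\<exists>l. ((\<lambda>t. norm (x t - z)) \<longlongrightarrow> l) at_top) \<and>
            set_integrable lebesgue {0..} (\<lambda>t. (norm (velocity x t))\<^sup>2) \<and>
            set_integrable lebesgue {0..} (\<lambda>t. lam t * bet t * inner (B (x t)) (x t - z)) \<and>
            set_integrable lebesgue {0..} (\<lambda>t. lam t * bet t * (norm (B (x t)))\<^sup>2)) \<and>
         (\<exists>w \<in> op_zer (op_add (op_add A (op_of_fun D)) (normal_cone C)).
            weakly_tendsto (weighted_average lam x) w at_top) \<and>
         (strongly_monotone A \<longrightarrow>
            (\<exists>w. op_zer (op_add (op_add A (op_of_fun D)) (normal_cone C)) = {w} \<and>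
                 (x \<longlongrightarrow> w) at_top))"
proof -
  let ?Z = "op_zer (op_add (op_add A (op_of_fun D)) (normal_cone C))"
  obtain N where N: "negligible N"
    "\<And>t. t \<in> {0..} - N \<Longrightarrow> (x has_vector_derivative velocity x t) (at t within {0..})"
    "\<And>t. t \<in> {0..} - N \<Longrightarrow> \<exists>a\<in>A (velocity x t + x t).
       velocity x t = - (lam t *\<^sub>R (a + D (x t) + bet t *\<^sub>R B (x t)))"
    using strong_global_solution_null_set[OF assms(12)] by blast
  define v where "v t = (if t \<in> N then 0 else velocity x t)" for t
  \<comment> \<open>The modulus stays open because it is taken to be 0 for (i) and (ii) and positive
    for (iii).\<close>
  have flow: "penalty_flow A D B \<gamma> \<eta> \<mu> lam bet x v N"
    if \<gamma>: "0 \<le> \<gamma>" "\<And>y a y' a'. a \<in> A y \<Longrightarrow> a' \<in> A y' \<Longrightarrow> inner (y - y') (a - a') \<ge> \<gamma> * (norm (y - y'))\<^sup>2"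
    for \<gamma>
  proof
    show "continuous_on {0..} lam" "continuous_on {0..} bet"
      using assms(9,11) by (auto intro: continuous_on_halfline)
    show "(\<lambda>t. (lam t)\<^sup>2) integrable_on {0..}"
      using assms(16) by (rule set_lebesgue_integral_eq_integral(1))
    show "\<not> lam integrable_on {0..}"
      using assms(8,17) nonnegative_absolutely_integrable_1[of lam "{0..}"] by (auto intro: less_imp_le)
    show "\<forall>\<^sub>F t in at_top. lam t * bet t \<le> 2 * \<mu>"
      using Limsup_lessD[OF assms(13)] by eventually_elim simp
    show "v t = 0" if "t \<in> N" for t using that by (simp add: v_def)
    show "(x has_vector_derivative v t) (at t within {0..})" if "t \<in> {0..} - N" for t
      using N(2)[OF that] that by (simp add: v_def)
    show "\<exists>a\<in>A (v t + x t). v t = - (lam t *\<^sub>R (a + D (x t) + bet t *\<^sub>R B (x t)))"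
      if "t \<in> {0..} - N" for t
      using N(3)[OF that] that by (simp add: v_def)
    show "\<exists>g. g integrable_on {0..b} \<and> (\<forall>t. 0 \<le> g t) \<and>
      (\<forall>s t. 0 \<le> s \<longrightarrow> s \<le> t \<longrightarrow> t \<le> b \<longrightarrow> norm (x t - x s) \<le> integral {s..t} g)"
      if b: "0 \<le> b" for b
    proof -
      \<comment> \<open>The horizon \<open>b + 1\<close> covers \<open>b = 0\<close>, since absolute
        continuity is given on intervals of positive length.\<close>
      have "abs_continuous_upto (b + 1) x" using assms(12) b by (simp add: strong_global_solution_def)
      then obtain g where g: "g integrable_on {0..b + 1}" "\<And>t. 0 \<le> g t"
        "\<And>s t. 0 \<le> s \<Longrightarrow> s \<le> t \<Longrightarrow> t \<le> b + 1 \<Longrightarrow> norm (x t - x s) \<le> integral {s..t} g"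
        using abs_continuous_upto_dominated[of "b + 1" x] b by auto
      have "g integrable_on {0..b}" by (rule integrable_subinterval_real[OF g(1)]) auto
      then show ?thesis using g(2,3) by (intro exI[of _ g]) auto
    qed
  qed (use assms N(1) \<gamma> in auto)
  have mono: "inner (y - y') (a - a') \<ge> 0" if "a \<in> A y" "a' \<in> A y'" for y a y' a'
    using assms(1) that monotone_opD unfolding maximally_monotone_def by blast
  interpret penalty_flow A D B 0 \<eta> \<mu> lam bet x v N
    by (rule flow) (use mono in auto)
  have BC: "B y = 0" if "y \<in> C" for y
    using that assms(6) by (simp add: op_zer_def op_of_fun_def)
  have gap: "gap u p integrable_on {0..}" if p: "p \<in> normal_cone C u" for u p
  proof (rule gap_integrable[OF BC p])
    \<comment> \<open>The normal cone is closed under positive scaling, so the integral condition is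
      available for \<open>6 *\<^sub>R p\<close>.\<close>
    have "6 *\<^sub>R p \<in> normal_cone C u"
      using p by (auto simp: normal_cone_def split: if_splits)
    then have "6 *\<^sub>R p \<in> op_ran (normal_cone C)" by (auto simp: op_ran_def)
    then show "halfline_integral (\<lambda>t. ereal (lam t * bet t) *
             ((SUP u\<in>C. fitzpatrick (op_of_fun B) u ((1 / bet t) *\<^sub>R (6 *\<^sub>R p)))
               - support_function C ((1 / bet t) *\<^sub>R (6 *\<^sub>R p)))) < \<infinity>"
      using assms(18) by blast
  qed
  have in_C: "u \<in> C" if "p \<in> normal_cone C u" for u p
    using that by (auto simp: normal_cone_def split: if_splits)
  have Z_iff: "z \<in> ?Z \<longleftrightarrow> (\<exists>a p. a \<in> A z \<and> p \<in> normal_cone C z \<and> a + D z + p = 0)" for z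
    by (auto simp: op_zer_def op_add_def op_of_fun_def)
  have Z: "\<exists>a p. B z = 0 \<and> a \<in> A z \<and> a + D z + p = 0 \<and> gap z p integrable_on {0..}" if "z \<in> ?Z" for z
    using that gap BC in_C unfolding Z_iff by blast
  have conv: "\<exists>l. ((\<lambda>t. norm (x t - z)) \<longlongrightarrow> l) at_top" if "z \<in> ?Z" for z
    using Z[OF that] energy_estimates(1) by blast
  have part1: "(\<exists>l. ((\<lambda>t. norm (x t - z)) \<longlongrightarrow> l) at_top) \<and>
            set_integrable lebesgue {0..} (\<lambda>t. (norm (velocity x t))\<^sup>2) \<and>
            set_integrable lebesgue {0..} (\<lambda>t. lam t * bet t * inner (B (x t)) (x t - z)) \<and>
            set_integrable lebesgue {0..} (\<lambda>t. lam t * bet t * (norm (B (x t)))\<^sup>2)" if z: "z \<in> ?Z" for z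
  proof -
    obtain a p where ap: "B z = 0" "a \<in> A z" "a + D z + p = 0" "gap z p integrable_on {0..}"
      using Z[OF z] by blast
    have step_nonneg: "0 \<le> lam t * bet t" if "0 \<le> t" for t
      using lam_pos[OF that] bet_pos[OF that] by simp
    note est = energy_estimates[OF ap]
    have "(\<lambda>t. (norm (velocity x t))\<^sup>2) integrable_on {0..}"
      by (rule integrable_spike[OF est(2) N(1)]) (simp add: v_def)
    then have "set_integrable lebesgue {0..} (\<lambda>t. (norm (velocity x t))\<^sup>2)"
      by (rule nonnegative_absolutely_integrable_1) simp
    moreover have "set_integrable lebesgue {0..} (\<lambda>t. lam t * bet t * inner (B (x t)) (x t - z))"
      by (rule nonnegative_absolutely_integrable_1[OF est(3)])
         (use step_nonneg B_inner_nonneg[OF ap(1)] in simp)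
    moreover have "set_integrable lebesgue {0..} (\<lambda>t. lam t * bet t * (norm (B (x t)))\<^sup>2)"
      by (rule nonnegative_absolutely_integrable_1[OF est(4)])
         (use step_nonneg in simp)
    ultimately show ?thesis using est(1) by blast
  qed
  obtain z0 where z0: "z0 \<in> ?Z" using assms(15) by blast
  obtain M0 where M0: "\<And>t. 0 \<le> t \<Longrightarrow> norm (x t - z0) \<le> M0"
    using Z[OF z0] trajectory_bounded by metis
  have limit_zero: "y \<in> ?Z"
    if y: "\<And>T. y \<in> closure (convex hull (weighted_average lam x ` {T..}))" for y
  proof -
    have "- D y \<in> op_add A (normal_cone C) y"
    proof (rule zero_of_maximally_monotone_plus_lipschitz[OF assms(14), of "1 / \<eta>"])
      fix u m assume "m \<in> op_add A (normal_cone C) u"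
      then obtain a p where m: "m = a + p" "a \<in> A u" "p \<in> normal_cone C u"
        by (auto simp: op_add_def)
      \<comment> \<open>\<open>u\<close> need not be a zero; the bound at the single zero
        \<open>z0\<close> reaches it by the triangle inequality.\<close>
      have "norm (x t - u) \<le> M0 + norm (z0 - u)" if "0 \<le> t" for t
        using M0[OF that] norm_triangle_ineq[of "x t - z0" "z0 - u"] by simp
      note ineq = average_variational_inequality[OF BC[OF in_C[OF m(3)]] m(2) refl gap[OF m(3)] this]
      have "inner (y - u) (a + D u + p) \<le> 0"
      proof (rule field_le_epsilon)
        fix e :: real assume "0 < e"
        have "inner y (a + D u + p) \<le> inner u (a + D u + p) + e"
          by (rule closure_hull_inner_le[OF _ y])
             (use ineq[OF _ \<open>0 < e\<close>] in \<open>simp add: inner_diff_left algebra_simps\<close>)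
        then show "inner (y - u) (a + D u + p) \<le> 0 + e" by (simp add: inner_diff_left)
      qed
      then show "0 \<le> inner (u - y) (m + D u)" by (simp add: m(1) algebra_simps)
    next
      show "norm (D y - D y') \<le> 1 / \<eta> * norm (y - y')" for y y'
        using cocoercive_lipschitz[OF assms(3,2)] by simp
    qed (use assms(2) in simp)
    then obtain a p where "- D y = a + p" "a \<in> A y" "p \<in> normal_cone C y"
      by (auto simp: op_add_def)
    moreover from this have "a + D y + p = 0" by (simp add: algebra_simps neg_eq_iff_add_eq_0)
    ultimately show ?thesis unfolding Z_iff by blast
  qed
  have part2: "\<exists>w \<in> ?Z. weakly_tendsto (weighted_average lam x) w at_top"
  proof -
    obtain T where "bounded (weighted_average lam x ` {T..})"
      using weighted_average_bounded[OF M0] by blast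
    then obtain w where "\<And>T. w \<in> closure (convex hull (weighted_average lam x ` {T..}))"
      "weakly_tendsto (weighted_average lam x) w at_top"
    proof (rule weakly_tendsto_of_hull_limits)
      fix y y' assume yy: "\<And>T. y \<in> closure (convex hull (weighted_average lam x ` {T..}))"
        "\<And>T. y' \<in> closure (convex hull (weighted_average lam x ` {T..}))"
      show "y = y'"
        using conv[OF limit_zero[OF yy(1)]] conv[OF limit_zero[OF yy(2)]] average_hull_unique[OF _ _ yy]
        by blast
    qed (rule that)
    then show ?thesis using limit_zero by blast
  qed
  have part3: "\<exists>w. ?Z = {w} \<and> (x \<longlongrightarrow> w) at_top" if sm: "strongly_monotone A"
  proof -
    obtain \<gamma> where \<gamma>: "\<gamma> > 0"
      "\<And>y a y' a'. a \<in> A y \<Longrightarrow> a' \<in> A y' \<Longrightarrow> inner (y - y') (a - a') \<ge> \<gamma> * (norm (y - y'))\<^sup>2"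
      using sm unfolding strongly_monotone_def op_graph_def by blast
    \<comment> \<open>\<open>gap\<close> does not involve \<open>\<gamma>\<close>, so its
      integrability carries over from the case \<open>\<gamma> = 0\<close>.\<close>
    interpret strong: penalty_flow A D B \<gamma> \<eta> \<mu> lam bet x v N
      by (rule flow) (use \<gamma> in auto)
    have lim: "(x \<longlongrightarrow> z) at_top" if "z \<in> ?Z" for z
      using Z[OF that] strong.strong_limit \<gamma>(1) by blast
    \<comment> \<open>Every zero is the limit of one and the same trajectory.\<close>
    have "z = z0" if "z \<in> ?Z" for z
      using tendsto_unique[OF _ lim[OF that] lim[OF z0]] by simp
    then show ?thesis using z0 lim by blast
  qed
  from part1 part2 part3 show ?thesis by blast
qed

end
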